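(* Let $\mu,\rho\in\mathbb{R}$, $\sigma_C^2>0$, $\sigma_E^2\ge0$, and let $(r_n)_{n\in\mathbb{N}}$ be a sequence with $r_n\to\infty$ and $r_n/n^{1/2}\to0$. Suppose that, as $n\to\infty$, $$\begin{pmatrix}r_n(\widehat{\beta}_C-\beta_0)\\ \sqrt{n}(\widehat{\beta}_E-\beta_E)\end{pmatrix}\xrightarrow{d}\mathcal{N}\left(\begin{pmatrix}\mu\\0\end{pmatrix},\begin{pmatrix}\sigma_C^2&\rho\\ \rho&\sigma_E^2\end{pmatrix}\right),$$ and $r_n^2\widehat{V}(\widehat{\beta}_C)\xrightarrow{p}\sigma_C^2$, $n\widehat{V}(\widehat{\beta}_E)\xrightarrow{p}\sigma_E^2$, $n^{1/2}r_n\widehat{\mathrm{cov}}(\widehat{\beta}_C,\widehat{\beta}_E)\xrightarrow{p}\rho$. Let $\widehat{\beta}_{MSE}$ be the empirical-MSE-minimizing estimator (defined in the context). Then: 1. If $\beta_0\neq\beta_E$ and $\beta_0$ and $\beta_E$ do not depend on $n$, then $r_n(\widehat{\beta}_{MSE}-\beta_0)\xrightarrow{d}\mathcal{N}(\mu,\sigma_C^2)$. 2. If $\beta_0=\beta_E$, then $r_n(\widehat{\beta}_{MSE}-\beta_0)\xrightarrow{d}U_0$, where $U_0$ is a random variable such that $E(U_0^2)<E(V^2)$, with $V\sim\mathcal{N}(\mu,\sigma_C^2)$. 3. If $|\mu/\sigma_C|\le0.4$, there is a family of random variables $(U_h)_{h\in\mathbb{R}}$ such that, for every $h\in\mathbb{R}$,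 if $\beta_E=\beta_0+h/r_n$ then $r_n(\widehat{\beta}_{MSE}-\beta_0)\xrightarrow{d}U_h$, and this family satisfies $$\max_{h\in\mathbb{R}}\left[E(U_h^2)-(\mu^2+\sigma_C^2)\right]<\max_{h\in\mathbb{R}}\left[\mu^2+\sigma_C^2-E(U_h^2)\right].$$
   Context: For each sample size $n$, $\widehat{\beta}_C$ and $\widehat{\beta}_E$ are real-valued random variables (estimators; the dependence on $n$ is suppressed), and $\beta_0,\beta_E\in\mathbb{R}$ are parameters, which may depend on $n$ unless stated otherwise (in Part 3, $\beta_E=\beta_0+h/r_n$ does). $\widehat{V}(\widehat{\beta}_C)$, $\widehat{V}(\widehat{\beta}_E)$ and $\widehat{\mathrm{cov}}(\widehat{\beta}_C,\widehat{\beta}_E)$ are real-valued random variables (estimators of the variances of $\widehat{\beta}_C$, $\widehat{\beta}_E$ and of their covariance). In Part 3 the stated hypotheses are assumed to hold, with the same $\mu,\rho,\sigma_C^2,\sigma_E^2,(r_n)$, along the sequence with $\beta_E=\beta_0+h/r_n$, for each $h$. $\sigma_C=\sqrt{\sigma_C^2}$. The empirical-MSE-minimizing estimator is $\widehat{\beta}_{MSE}=\widehat{p}\,\widehat{\beta}_E+(1-\widehat{p})\,\widehat{\beta}_C$, where $$\widehat{p}=\arg\min_{p\in\mathbb{R}}\; p^2(\widehat{\beta}_E-\widehat{\beta}_C)^2+p^2\widehat{V}(\widehat{\beta}_E)+(1-p)^2\widehat{V}(\widehat{\beta}_C)+2p(1-p)\widehat{\mathrm{cov}}(\widehat{\beta}_C,\widehat{\beta}_E),$$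 that is, $$\widehat{p}=\frac{\widehat{V}(\widehat{\beta}_C)-\widehat{\mathrm{cov}}(\widehat{\beta}_C,\widehat{\beta}_E)}{(\widehat{\beta}_E-\widehat{\beta}_C)^2+\widehat{V}(\widehat{\beta}_E-\widehat{\beta}_C)},\qquad \widehat{V}(\widehat{\beta}_E-\widehat{\beta}_C)=\widehat{V}(\widehat{\beta}_E)+\widehat{V}(\widehat{\beta}_C)-2\widehat{\mathrm{cov}}(\widehat{\beta}_C,\widehat{\beta}_E).$$ (The denominator is positive with probability tending to one; the value of $\widehat{p}$ elsewhere is immaterial.) $\xrightarrow{d}$ and $\xrightarrow{p}$ denote convergence in distribution and in probability. *)

theory Defs
  imports "HOL-Probability.Probability"
begin

section \<open>Normal distributions and modes of convergence\<close>

text \<open>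
  The second parameter is the variance (not the standard deviation), and a zero variance
  gives a point mass. Only meaningful for \<open>v \<ge> 0\<close>.
\<close>

definition normal_law :: "real \<Rightarrow> real \<Rightarrow> real measure" where
  "normal_law m v =
     (if v = 0 then return borel m else density lborel (\<lambda>x. ennreal (normal_density m (sqrt v) x)))"

text \<open>
  Multivariate normal law with mean vector \<open>m\<close> and a possibly singular covariance matrix \<open>S\<close>:
  the law on \<open>\<real>\<^sup>n\<close> all of whose linear functionals \<open>x \<mapsto> t \<bullet> x\<close> are normal with mean
  \<open>t \<bullet> m\<close> and variance \<open>t\<^sup>T S t\<close>. The conditions on \<open>S\<close> say that it is symmetric and
  positive semidefinite. The law is unique by the Cramer--Wold theorem.
\<close>

definition is_mv_normal :: "real ^ 'n \<Rightarrow> real ^ 'n ^ 'n \<Rightarrow> (real ^ 'n) measure \<Rightarrow> bool" where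
  "is_mv_normal m S N \<longleftrightarrow>
     prob_space N \<and> sets N = sets borel \<and> transpose S = S \<and>
     (\<forall>t. 0 \<le> t \<bullet> (S *v t) \<and>
          distr N borel (\<lambda>x. t \<bullet> x) = normal_law (t \<bullet> m) (t \<bullet> (S *v t)))"

text \<open>
  Weak convergence of Borel laws on a general space; on the real line \<^const>\<open>weak_conv_m\<close>
  from the library is used instead.
\<close>

definition weak_conv_borel :: "(nat \<Rightarrow> 'a::topological_space measure) \<Rightarrow> 'a measure \<Rightarrow> bool" where
  "weak_conv_borel P Q \<longleftrightarrow>
     (\<forall>f :: 'a \<Rightarrow> real. continuous_on UNIV f \<and> bounded (range f) \<longrightarrow>
        (\<lambda>n. \<integral>x. f x \<partial>P n) \<longlonglongrightarrow> (\<integral>x. f x \<partial>Q))"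

definition conv_in_prob :: "(nat \<Rightarrow> 'w measure) \<Rightarrow> (nat \<Rightarrow> 'w \<Rightarrow> real) \<Rightarrow> real \<Rightarrow> bool" where
  "conv_in_prob P X c \<longleftrightarrow>
     (\<forall>\<epsilon>>0. (\<lambda>n. measure (P n) {\<omega> \<in> space (P n). \<bar>X n \<omega> - c\<bar> > \<epsilon>}) \<longlonglongrightarrow> 0)"


section \<open>The empirical-MSE-minimizing estimator\<close>

text \<open>
  The data at one sample size: a probability space, the two estimators \<open>C\<close> and \<open>E\<close>, the
  estimators of their variances and of their covariance.
\<close>

record 'w estimation =
  sample_law :: "'w measure"
  est_C :: "'w \<Rightarrow> real"
  est_E :: "'w \<Rightarrow> real"
  var_C :: "'w \<Rightarrow> real"
  var_E :: "'w \<Rightarrow> real"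
  cov_CE :: "'w \<Rightarrow> real"

definition valid_estimation :: "'w estimation \<Rightarrow> bool" where
  "valid_estimation D \<longleftrightarrow>
     prob_space (sample_law D) \<and>
     est_C D \<in> borel_measurable (sample_law D) \<and>
     est_E D \<in> borel_measurable (sample_law D) \<and>
     var_C D \<in> borel_measurable (sample_law D) \<and>
     var_E D \<in> borel_measurable (sample_law D) \<and>
     cov_CE D \<in> borel_measurable (sample_law D)"

definition empirical_mse :: "'w estimation \<Rightarrow> 'w \<Rightarrow> real \<Rightarrow> real" where
  "empirical_mse D \<omega> p =
     p\<^sup>2 * (est_E D \<omega> - est_C D \<omega>)\<^sup>2 + p\<^sup>2 * var_E D \<omega> + (1 - p)\<^sup>2 * var_C D \<omega>
     + 2 * p * (1 - p) * cov_CE D \<omega>"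

text \<open>
  If \<^const>\<open>empirical_mse\<close> has no minimizer or is constant in \<open>p\<close>, this is a fixed but
  unspecified real number; see \<open>mse_weight_eq\<close> for the remaining case.
\<close>

definition mse_weight :: "'w estimation \<Rightarrow> 'w \<Rightarrow> real" where
  "mse_weight D \<omega> = (ARG_MIN (empirical_mse D \<omega>) p. True)"

definition est_MSE :: "'w estimation \<Rightarrow> 'w \<Rightarrow> real" where
  "est_MSE D \<omega> = mse_weight D \<omega> * est_E D \<omega> + (1 - mse_weight D \<omega>) * est_C D \<omega>"

lemma mse_weight_eq:
  fixes D :: "'w estimation"
  defines "den \<equiv> \<lambda>\<omega>. (est_E D \<omega> - est_C D \<omega>)\<^sup>2 + (var_E D \<omega> + var_C D \<omega> - 2 * cov_CE D \<omega>)"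
  assumes pos: "den \<omega> > 0"
  shows "mse_weight D \<omega> = (var_C D \<omega> - cov_CE D \<omega>) / den \<omega>"
proof -
  define q where "q = (var_C D \<omega> - cov_CE D \<omega>) / den \<omega>"
  have q: "var_C D \<omega> - cov_CE D \<omega> = den \<omega> * q"
    using pos by (simp add: q_def)
  have "empirical_mse D \<omega> p =
      den \<omega> * p\<^sup>2 - 2 * (var_C D \<omega> - cov_CE D \<omega>) * p + var_C D \<omega>" for p
    by (simp add: empirical_mse_def den_def power2_eq_square algebra_simps)
  then have eq: "empirical_mse D \<omega> p = den \<omega> * (p - q)\<^sup>2 + (var_C D \<omega> - den \<omega> * q\<^sup>2)" for p
    unfolding q by (simp add: power2_eq_square algebra_simps)
  have "is_arg_min (empirical_mse D \<omega>) (\<lambda>_. True) p \<longleftrightarrow> p = q" for p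
  proof
    assume "is_arg_min (empirical_mse D \<omega>) (\<lambda>_. True) p"
    then have "den \<omega> * (p - q)\<^sup>2 \<le> 0"
      by (auto simp: is_arg_min_def eq not_less dest: spec[of _ q])
    with pos show "p = q"
      by (simp add: mult_le_0_iff)
  next
    assume "p = q"
    with pos show "is_arg_min (empirical_mse D \<omega>) (\<lambda>_. True) p"
      by (auto simp: is_arg_min_def eq not_less)
  qed
  then show ?thesis
    by (simp add: mse_weight_def arg_min_def q_def)
qed


section \<open>The asymptotic setting\<close>

text \<open>
  \<open>b0\<close> and \<open>bE\<close> are the parameters at each sample size, \<open>sC2\<close> and \<open>sE2\<close> the limiting variances.
\<close>

definition asymptotic_setting ::
    "real \<Rightarrow> real \<Rightarrow> real \<Rightarrow> real \<Rightarrow> (nat \<Rightarrow> real) \<Rightarrow> (nat \<Rightarrow> real) \<Rightarrow> (nat \<Rightarrow> real)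
      \<Rightarrow> (nat \<Rightarrow> 'w estimation) \<Rightarrow> bool" where
  "asymptotic_setting \<mu> \<rho> sC2 sE2 r b0 bE D \<longleftrightarrow>
     (\<forall>n. valid_estimation (D n)) \<and>
     (\<exists>N. is_mv_normal (vector [\<mu>, 0] :: real ^ 2)
            (vector [vector [sC2, \<rho>], vector [\<rho>, sE2]] :: real ^ 2 ^ 2) N \<and>
          weak_conv_borel
            (\<lambda>n. distr (sample_law (D n)) borel
               (\<lambda>\<omega>. vector [r n * (est_C (D n) \<omega> - b0 n),
                              sqrt (real n) * (est_E (D n) \<omega> - bE n)] :: real ^ 2))
            N) \<and>
     conv_in_prob (\<lambda>n. sample_law (D n)) (\<lambda>n \<omega>. (r n)\<^sup>2 * var_C (D n) \<omega>) sC2 \<and>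
     conv_in_prob (\<lambda>n. sample_law (D n)) (\<lambda>n \<omega>. real n * var_E (D n) \<omega>) sE2 \<and>
     conv_in_prob (\<lambda>n. sample_law (D n)) (\<lambda>n \<omega>. sqrt (real n) * r n * cov_CE (D n) \<omega>) \<rho>"

definition scaled_MSE_law :: "(nat \<Rightarrow> real) \<Rightarrow> (nat \<Rightarrow> real) \<Rightarrow> (nat \<Rightarrow> 'w estimation) \<Rightarrow> nat \<Rightarrow> real measure" where
  "scaled_MSE_law r b0 D n =
     distr (sample_law (D n)) borel (\<lambda>\<omega>. r n * (est_MSE (D n) \<omega> - b0 n))"

end

theory Submission
  imports Defs
begin

text \<open>
  With \<open>X = r\<^sub>n (C - \<beta>\<^sub>0)\<close> and \<open>w = r\<^sub>n (E - C)\<close>, the scaled estimator is \<open>X + A w / (w\<^sup>2 + B)\<close>, where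
  \<open>A\<close> and \<open>B\<close> tend to \<open>\<sigma>\<^sup>2\<close> in probability and \<open>w + X - r\<^sub>n (\<beta>\<^sub>E - \<beta>\<^sub>0)\<close> tends to 0. If \<open>\<beta>\<^sub>E \<noteq> \<beta>\<^sub>0\<close> is
  fixed, \<open>\<bar>w\<bar>\<close> tends to infinity and the correction vanishes; if \<open>\<beta>\<^sub>E = \<beta>\<^sub>0 + h / r\<^sub>n\<close>, the limit is \<open>u\<^sub>h(V)\<close> with
  \<open>u\<^sub>h x = x + \<sigma>\<^sup>2 (h - x) / ((h - x)\<^sup>2 + \<sigma>\<^sup>2)\<close>, and \<open>\<bar>u\<^sub>0 x\<bar> < \<bar>x\<bar>\<close> for \<open>x \<noteq> 0\<close>.

  For the third part, Stein's identity turns \<open>E (u\<^sub>h(V)\<^sup>2) - E (V\<^sup>2)\<close> into the mean of an explicit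
  bounded rational function \<open>\<phi>\<^sub>m\<close>, affine in \<open>m = - \<mu> / \<sigma>\<close>, under a normal law with variance 1 and
  varying centre. By symmetry and interpolation only \<open>m = 0\<close> and \<open>m = 2/5\<close> matter. Upper bounds for such
  means come again from Stein's identity: \<open>(z - k) f z - f' z\<close> has mean 0 under the normal law with centre \<open>k\<close>,
  so a pointwise bound for \<open>\<phi>\<^sub>m z + (z - k) f z - f' z\<close> with a well-chosen rational \<open>f\<close> bounds the mean,
  and it amounts to the nonnegativity of a polynomial, which is certified by squares.
\<close>

subsection \<open>Gaussian means and Stein's identity\<close>

interpretation std_normal: prob_space std_normal_distribution
  by (rule prob_space_normal_density) simp

text \<open>The normal law with centre \<open>k\<close> and variance 1 is realized by a shift of the
  argument, so that \<open>k\<close> enters only the integrand and limits in \<open>k\<close> are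
  accessible to dominated convergence.\<close>

definition gauss_mean :: "real \<Rightarrow> (real \<Rightarrow> real) \<Rightarrow> real" where
  "gauss_mean k f = (\<integral>x. f (k + x) \<partial>std_normal_distribution)"

lemma integrable_gauss_bounded:
  fixes f :: "real \<Rightarrow> real"
  assumes [measurable]: "f \<in> borel_measurable borel" and "\<And>z. \<bar>f z\<bar> \<le> B"
  shows "integrable std_normal_distribution (\<lambda>x. f (k + x))"
  by (rule std_normal.integrable_const_bound[where B = B]) (use assms(2) in auto)

lemma has_real_derivative_std_normal_density:
  "(std_normal_density has_real_derivative - x * std_normal_density x) (at x)"
proof -
  define c where "c = 1 / sqrt (2 * pi)"
  have "((\<lambda>x. c * exp (- x\<^sup>2 / 2)) has_real_derivative - x * (c * exp (- x\<^sup>2 / 2))) (at x)"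
    by (auto intro!: derivative_eq_intros simp: power2_eq_square)
  then show ?thesis
    unfolding c_def std_normal_density_def [abs_def] .
qed

lemma std_normal_density_at_top: "(std_normal_density \<longlongrightarrow> 0) at_top"
proof -
  have "((\<lambda>x::real. exp (- x\<^sup>2 / 2)) \<longlongrightarrow> 0) at_top"
    by real_asymp
  from tendsto_mult_right_zero[OF this] show ?thesis
    unfolding std_normal_density_def [abs_def] .
qed

lemma std_normal_density_at_bot: "(std_normal_density \<longlongrightarrow> 0) at_bot"
proof -
  have "((\<lambda>x::real. exp (- x\<^sup>2 / 2)) \<longlongrightarrow> 0) at_bot"
    by real_asymp
  from tendsto_mult_right_zero[OF this] show ?thesis
    unfolding std_normal_density_def [abs_def] .
qed

lemma integrable_gauss_bounded_times:
  fixes f :: "real \<Rightarrow> real"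
  assumes [measurable]: "f \<in> borel_measurable borel" and B: "\<And>z. \<bar>f z\<bar> \<le> B"
  shows "integrable std_normal_distribution (\<lambda>x. x * f (k + x))"
proof (rule Bochner_Integration.integrable_bound)
  show "integrable std_normal_distribution (\<lambda>x. B * x)"
    using integrable_std_normal_distribution_moment[of 1] by simp
  have "norm (x * f (k + x)) \<le> norm (B * x)" for x
    using mult_left_mono[OF order_trans[OF B abs_ge_self], of "\<bar>x\<bar>"]
    by (simp add: abs_mult mult.commute)
  then show "AE x in std_normal_distribution. norm (x * f (k + x)) \<le> norm (B * x)"
    by simp
qed simp

text \<open>Each monomial \<open>\<bar>z\<bar> ^ i\<close> with \<open>i \<le> 2 * m\<close> is at
  most \<open>(1 + z\<^sup>2) ^ m\<close>, so the sum of the absolute values of the coefficients is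
  a bound.\<close>

lemma rational_bounded:
  fixes p :: "real poly"
  assumes "degree p \<le> 2 * m"
  obtains B where "\<And>z. \<bar>poly p z / (1 + z\<^sup>2) ^ m\<bar> \<le> B"
proof
  fix z :: real
  have mono: "\<bar>z\<bar> ^ i \<le> (1 + z\<^sup>2) ^ m" if "i \<le> 2 * m" for i
  proof (cases "\<bar>z\<bar> \<le> 1")
    case True
    then have "\<bar>z\<bar> ^ i \<le> 1" by (simp add: power_le_one)
    also have "1 \<le> (1 + z\<^sup>2) ^ m" by (simp add: one_le_power)
    finally show ?thesis .
  next
    case False
    then have "\<bar>z\<bar> ^ i \<le> \<bar>z\<bar> ^ (2 * m)"
      using that by (intro power_increasing) auto
    also have "\<dots> = (z\<^sup>2) ^ m" by (simp add: power_mult)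
    also have "\<dots> \<le> (1 + z\<^sup>2) ^ m" by (intro power_mono) auto
    finally show ?thesis .
  qed
  have "\<bar>poly p z\<bar> \<le> (\<Sum>i\<le>degree p. \<bar>coeff p i\<bar> * \<bar>z\<bar> ^ i)"
    unfolding poly_altdef by (rule order_trans[OF sum_abs]) (simp add: abs_mult power_abs)
  also have "\<dots> \<le> (\<Sum>i\<le>degree p. \<bar>coeff p i\<bar> * (1 + z\<^sup>2) ^ m)"
    using assms by (intro sum_mono mult_left_mono mono) auto
  also have "\<dots> = (\<Sum>i\<le>degree p. \<bar>coeff p i\<bar>) * (1 + z\<^sup>2) ^ m"
    by (simp add: sum_distrib_right)
  finally show "\<bar>poly p z / (1 + z\<^sup>2) ^ m\<bar> \<le> (\<Sum>i\<le>degree p. \<bar>coeff p i\<bar>)"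
    by (simp add: abs_mult field_simps add_pos_nonneg)
qed

lemma one_plus_square_pos: "0 < 1 + (z::real)\<^sup>2"
  by (simp add: add_pos_nonneg)

lemma continuous_on_rational:
  "continuous_on A (\<lambda>z::real. poly p z / (1 + z\<^sup>2) ^ m)"
  using one_plus_square_pos by (intro continuous_intros) (metis less_irrefl power_eq_0_iff)+

text \<open>Times the normal density, the integrand is the derivative of \<open>F\<close>, minus the
  density times the shifted \<open>f\<close>. As \<open>f\<close> is bounded, \<open>F\<close>
  vanishes at both infinities, and the fundamental theorem of calculus on the whole line gives
  0.\<close>

lemma gauss_mean_stein:
  assumes der: "\<And>z. (f has_real_derivative f' z) (at z)"
    and cont: "continuous_on UNIV f'"
    and B: "\<And>z. \<bar>f z\<bar> \<le> B" and B': "\<And>z. \<bar>f' z\<bar> \<le> B'"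
  shows "gauss_mean k (\<lambda>z. (z - k) * f z - f' z) = 0"
proof -
  have contf: "continuous_on UNIV f"
    using der DERIV_isCont by (auto intro!: continuous_at_imp_continuous_on)
  have [measurable]: "f \<in> borel_measurable borel" "f' \<in> borel_measurable borel"
    using contf cont by (auto intro: borel_measurable_continuous_onI)
  let ?n = std_normal_density
  define F where "F = (\<lambda>x. - (?n x * f (k + x)))"
  define G where "G = (\<lambda>x. ?n x * (x * f (k + x) - f' (k + x)))"
  have F: "(F has_real_derivative G x) (at x)" for x
  proof -
    have "((\<lambda>x. f (k + x)) has_real_derivative f' (k + x)) (at x)"
      using DERIV_shift[of f "f' (k + x)" x k] der[of "k + x"] by (simp add: add.commute)
    then show ?thesis
      unfolding F_def G_def
      by (auto intro!: derivative_eq_intros has_real_derivative_std_normal_density simp: algebra_simps)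
  qed
  have contG: "isCont G x" for x
  proof -
    have "continuous_on UNIV ?n"
      using has_real_derivative_std_normal_density DERIV_isCont
      by (auto intro!: continuous_at_imp_continuous_on)
    moreover have "continuous_on UNIV (\<lambda>x. f (k + x))" "continuous_on UNIV (\<lambda>x. f' (k + x))"
      using continuous_on_compose2[OF contf, of UNIV "\<lambda>x. k + x"]
        continuous_on_compose2[OF cont, of UNIV "\<lambda>x. k + x"]
      by (simp_all add: continuous_on_add)
    ultimately have "continuous_on UNIV G"
      unfolding G_def by (intro continuous_intros)
    then show ?thesis
      by (simp add: continuous_on_eq_continuous_at)
  qed
  have int: "integrable std_normal_distribution (\<lambda>x. x * f (k + x) - f' (k + x))"
    by (intro Bochner_Integration.integrable_diff integrable_gauss_bounded_times integrable_gauss_bounded)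
      (use B B' in auto)
  then have intG: "integrable lborel G"
    unfolding G_def by (subst (asm) integrable_density) auto
  have lim: "(F \<longlongrightarrow> 0) L" if "(?n \<longlongrightarrow> 0) L" for L
  proof -
    have "((\<lambda>x. B * ?n x) \<longlongrightarrow> 0) L"
      using tendsto_mult[OF tendsto_const that, of B] by simp
    moreover have "norm (F x) \<le> norm (B * ?n x) * 1" for x
      using mult_left_mono[OF order_trans[OF B[of "k + x"] abs_ge_self[of B]], of "?n x"]
      by (simp add: F_def abs_mult mult.commute)
    ultimately show ?thesis
      by (rule tendsto_0_le[OF _ always_eventually[OF allI]])
  qed
  have "(LBINT x=-\<infinity>..\<infinity>. G x) = 0 - 0"
  proof (rule interval_integral_FTC_integrable)
    show "(F has_vector_derivative G x) (at x)" for x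
      using F by (simp add: has_real_derivative_iff_has_vector_derivative)
    show "set_integrable lborel (einterval (-\<infinity>) \<infinity>) G"
      using intG by (simp add: set_integrable_def)
    show "((F \<circ> real_of_ereal) \<longlongrightarrow> 0) (at_right (-\<infinity>))"
      unfolding ereal_tendsto_simps by (intro lim std_normal_density_at_bot)
    show "((F \<circ> real_of_ereal) \<longlongrightarrow> 0) (at_left \<infinity>)"
      unfolding ereal_tendsto_simps by (intro lim std_normal_density_at_top)
  qed (use contG in \<open>simp_all\<close>)
  then have "(\<integral>x. G x \<partial>lborel) = 0"
    by (simp add: interval_lebesgue_integral_def set_lebesgue_integral_def)
  then show ?thesis
    unfolding gauss_mean_def G_def by (subst integral_density) auto
qed

text \<open>Here \<open>g\<close> is \<open>(z - k) * f z - f' z\<close> for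
  \<open>f = q / (1 + z\<^sup>2) ^ (m + 1)\<close>, brought to a common denominator. The degree
  condition makes \<open>f\<close> and \<open>f'\<close> bounded.\<close>

lemma gauss_mean_stein_rational:
  fixes k :: real
  assumes deg: "degree q < 2 * Suc m"
  defines "g \<equiv> \<lambda>z. (((z - k) * poly q z - poly (pderiv q) z) * (1 + z\<^sup>2) + 2 * real (Suc m) * z * poly q z)
      / (1 + z\<^sup>2) ^ (m + 2)"
  shows "gauss_mean k g = 0"
proof -
  define f where "f = (\<lambda>z. poly q z / (1 + z\<^sup>2) ^ Suc m)"
  \<comment> \<open>The numerator of the derivative of \<open>f\<close> after one factor
    \<open>(1 + z\<^sup>2) ^ m\<close> is cancelled in the quotient rule.\<close>
  define q' where "q' = pderiv q * [:1, 0, 1:] - [:0, 2 * real (Suc m):] * q"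
  define f' where "f' = (\<lambda>z. poly q' z / (1 + z\<^sup>2) ^ (m + 2))"
  have "degree (pderiv q * [:1, 0, 1:]) \<le> 2 * (m + 2)"
    using deg degree_mult_le[of "pderiv q" "[:1, 0, 1:]"] by (simp add: degree_pderiv)
  moreover have "degree ([:0, 2 * real (Suc m):] * q) \<le> 2 * (m + 2)"
    using deg degree_mult_le[of "[:0, 2 * real (Suc m):]" q] by (simp split: if_splits)
  ultimately have "degree q' \<le> 2 * (m + 2)"
    unfolding q'_def by (rule degree_diff_le)
  from rational_bounded[OF this] obtain B' where B': "\<bar>f' z\<bar> \<le> B'" for z
    unfolding f'_def by blast
  from deg have "degree q \<le> 2 * Suc m" by simp
  from rational_bounded[OF this] obtain B where B: "\<bar>f z\<bar> \<le> B" for z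
    unfolding f_def by blast
  have der: "(f has_real_derivative f' z) (at z)" for z
  proof -
    have W: "(1 + z\<^sup>2) \<noteq> 0" using one_plus_square_pos[of z] by simp
    have "(f has_real_derivative
        (poly (pderiv q) z * (1 + z\<^sup>2) ^ Suc m - poly q z * (real (Suc m) * (1 + z\<^sup>2) ^ m * (2 * z)))
          / ((1 + z\<^sup>2) ^ Suc m * (1 + z\<^sup>2) ^ Suc m)) (at z)"
      unfolding f_def using W
      by (auto intro!: derivative_eq_intros poly_DERIV simp del: power_Suc)
    also have "(poly (pderiv q) z * (1 + z\<^sup>2) ^ Suc m - poly q z * (real (Suc m) * (1 + z\<^sup>2) ^ m * (2 * z)))
          / ((1 + z\<^sup>2) ^ Suc m * (1 + z\<^sup>2) ^ Suc m) = f' z"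
    proof -
      define w where "w = 1 + z\<^sup>2"
      have "poly q' z = poly (pderiv q) z * w - 2 * real (Suc m) * z * poly q z"
        unfolding q'_def w_def by (simp add: algebra_simps power2_eq_square)
      moreover have "w \<noteq> 0" using W by (simp add: w_def)
      ultimately show ?thesis
        unfolding f'_def w_def [symmetric]
        by (simp add: divide_simps) (simp add: algebra_simps)
    qed
    finally show ?thesis .
  qed
  have "(z - k) * f z - f' z = g z" for z
  proof -
    have W: "(1 + z\<^sup>2) \<noteq> 0" using one_plus_square_pos[of z] by simp
    have "f z = poly q z * (1 + z\<^sup>2) / (1 + z\<^sup>2) ^ (m + 2)"
      using W by (simp add: f_def)
    moreover have "poly q' z = poly (pderiv q) z * (1 + z\<^sup>2) - 2 * real (Suc m) * z * poly q z"
      unfolding q'_def by (simp add: algebra_simps power2_eq_square)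
    moreover have "(z - k) * (a * w / d) - (b * w - c) / d = (((z - k) * a - b) * w + c) / d" for a b c d w :: real
      by (simp add: algebra_simps diff_divide_distrib add_divide_distrib)
    ultimately show ?thesis
      unfolding f'_def g_def by (simp only:)
  qed
  moreover have "gauss_mean k (\<lambda>z. (z - k) * f z - f' z) = 0"
    by (rule gauss_mean_stein[OF der _ B B']) (simp add: f'_def continuous_on_rational del: power_Suc)
  ultimately show ?thesis by simp
qed

subsection \<open>Certified bounds for Gaussian means of rational functions\<close>

text \<open>
  Numerator of \<open>c - \<phi> z - ((z - k) * f z - f' z)\<close> for \<open>\<phi> = p / (1 + z\<^sup>2)\<^sup>2\<close> and
  \<open>f = q / (1 + z\<^sup>2) ^ (m + 1)\<close>. By Stein's identity the Gaussian mean of \<open>\<phi>\<close> centred at \<open>k\<close> is at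
  most \<open>c\<close> as soon as this polynomial is nonnegative.
\<close>
definition slack_poly :: "real \<Rightarrow> real poly \<Rightarrow> nat \<Rightarrow> real poly \<Rightarrow> real \<Rightarrow> real poly" where
  "slack_poly c p m q k =
     smult c ([:1, 0, 1:] ^ (m + 2)) - p * [:1, 0, 1:] ^ m
       - ([:-k, 1:] * q - pderiv q) * [:1, 0, 1:] - [:0, 2 * real (Suc m):] * q"

lemma gauss_mean_rational_le:
  assumes deg: "degree q < 2 * Suc m" and degp: "degree p \<le> 4"
    and slack: "\<And>z. 0 \<le> poly (slack_poly c p m q k) z"
  shows "gauss_mean k (\<lambda>z. poly p z / (1 + z\<^sup>2)\<^sup>2) \<le> c"
proof -
  \<comment> \<open>The numerator of the Stein term. The strict bound on \<open>degree q\<close>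
    leaves room for the factor \<open>z - k\<close>, so that the quotient \<open>g\<close> is
    bounded and hence integrable.\<close>
  define s where "s = ([:-k, 1:] * q - pderiv q) * [:1, 0, 1:] + [:0, 2 * real (Suc m):] * q"
  define g where "g = (\<lambda>z. poly s z / (1 + z\<^sup>2) ^ (m + 2))"
  define \<phi> where "\<phi> = (\<lambda>z. poly p z / (1 + z\<^sup>2)\<^sup>2)"
  have "g = (\<lambda>z. (((z - k) * poly q z - poly (pderiv q) z) * (1 + z\<^sup>2) + 2 * real (Suc m) * z * poly q z)
      / (1 + z\<^sup>2) ^ (m + 2))"
    unfolding g_def s_def by (rule ext) (simp add: algebra_simps power2_eq_square)
  then have g0: "gauss_mean k g = 0"
    using gauss_mean_stein_rational[OF deg, of k] by simp
  have "degree ([:-k, 1:] * q - pderiv q) \<le> 2 * m + 2"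
    using deg degree_mult_le[of "[:-k, 1:]" q]
    by (intro degree_diff_le) (simp_all add: degree_pderiv)
  then have "degree (([:-k, 1:] * q - pderiv q) * [:1, 0, 1:]) \<le> 2 * (m + 2)"
    using degree_mult_le[of "[:-k, 1:] * q - pderiv q" "[:1, 0, 1:]"] by simp
  moreover have "degree ([:0, 2 * real (Suc m):] * q) \<le> 2 * (m + 2)"
    using deg degree_mult_le[of "[:0, 2 * real (Suc m):]" q] by (simp split: if_splits)
  ultimately have "degree s \<le> 2 * (m + 2)"
    unfolding s_def by (rule degree_add_le)
  from rational_bounded[OF this] obtain B where B: "\<bar>g z\<bar> \<le> B" for z
    unfolding g_def by blast
  from degp have "degree p \<le> 2 * 2" by simp
  from rational_bounded[OF this] obtain C where C: "\<bar>\<phi> z\<bar> \<le> C" for z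
    unfolding \<phi>_def by blast
  have [measurable]: "g \<in> borel_measurable borel" "\<phi> \<in> borel_measurable borel"
    unfolding g_def \<phi>_def by (intro borel_measurable_continuous_onI continuous_on_rational)+
  have "\<phi> z + g z \<le> c" for z
  proof -
    have W: "0 < (1 + z\<^sup>2) ^ (m + 2)" using one_plus_square_pos[of z] by simp
    have "\<phi> z = poly p z * (1 + z\<^sup>2) ^ m / (1 + z\<^sup>2) ^ (m + 2)"
      using one_plus_square_pos[of z] by (simp add: \<phi>_def power_add power2_eq_square)
    then have "\<phi> z + g z = (poly p z * (1 + z\<^sup>2) ^ m + poly s z) / (1 + z\<^sup>2) ^ (m + 2)"
      unfolding g_def by (simp add: add_divide_distrib)
    also have "\<dots> \<le> c"
      using slack[of z] W
      by (simp add: divide_le_eq s_def slack_poly_def poly_power power2_eq_square algebra_simps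
          del: power_Suc)
    finally show ?thesis .
  qed
  then have "(\<integral>x. \<phi> (k + x) + g (k + x) \<partial>std_normal_distribution) \<le> c"
    by (intro std_normal.integral_le_const Bochner_Integration.integrable_add
        integrable_gauss_bounded[OF _ B] integrable_gauss_bounded[OF _ C]) auto
  moreover have "(\<integral>x. \<phi> (k + x) + g (k + x) \<partial>std_normal_distribution) = gauss_mean k \<phi> + gauss_mean k g"
    unfolding gauss_mean_def
    by (intro Bochner_Integration.integral_add integrable_gauss_bounded[OF _ B] integrable_gauss_bounded[OF _ C]) auto
  ultimately show ?thesis
    using g0 unfolding \<phi>_def by simp
qed

lemma poly_slack_poly:
  "poly (slack_poly c p m q k) z = poly (slack_poly c p m q k') z + (k - k') * (poly q z * (1 + z\<^sup>2))"
  by (simp add: slack_poly_def poly_power power2_eq_square algebra_simps)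

lemma slack_poly_mono:
  assumes "k' \<le> k" "0 \<le> poly q z" "0 \<le> poly (slack_poly c p m q k') z"
  shows "0 \<le> poly (slack_poly c p m q k) z"
  using assms unfolding poly_slack_poly[of c p m q k z k']
  by (intro add_nonneg_nonneg mult_nonneg_nonneg) auto

lemma slack_poly_antimono:
  assumes "k \<le> k'" "poly q z \<le> 0" "0 \<le> poly (slack_poly c p m q k') z"
  shows "0 \<le> poly (slack_poly c p m q k) z"
  using assms unfolding poly_slack_poly[of c p m q k z k']
  by (intro add_nonneg_nonneg mult_nonpos_nonpos mult_nonpos_nonneg) auto

text \<open>The sign of \<open>q\<close> may vary with \<open>z\<close>: where \<open>q\<close> is
  nonnegative the certificate at \<open>k'\<close> carries over to larger centres, elsewhere the one
  at \<open>k''\<close> carries over to smaller ones.\<close>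

lemma slack_poly_between:
  assumes "k' \<le> k" "k \<le> k''"
    and "0 \<le> poly (slack_poly c p m q k') z" "0 \<le> poly (slack_poly c p m q k'') z"
  shows "0 \<le> poly (slack_poly c p m q k) z"
  using assms slack_poly_mono slack_poly_antimono by (cases "0 \<le> poly q z") fastforce+

text \<open>
  Coefficients are listed from degree 0 upwards; each odd term is absorbed by its two neighbours
  through \<open>\<bar>z ^ (2 * i + 1)\<bar> \<le> (z ^ (2 * i) + z ^ (2 * i + 2)) / 2\<close>.
\<close>
fun dominated_odd :: "real list \<Rightarrow> bool" where
  "dominated_odd [] \<longleftrightarrow> True"
| "dominated_odd [a] \<longleftrightarrow> 0 \<le> a"
| "dominated_odd [a, b] \<longleftrightarrow> False"
| "dominated_odd (a # b # c # cs) \<longleftrightarrow> \<bar>b\<bar> / 2 \<le> a \<and> dominated_odd ((c - \<bar>b\<bar> / 2) # cs)"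

lemma dominated_odd_imp_nonneg:
  "dominated_odd cs \<Longrightarrow> 0 \<le> poly (Poly cs) z"
proof (induction cs rule: dominated_odd.induct)
  case (4 a b c cs)
  \<comment> \<open>The sign inside the square is chosen so that its cross term is exactly
    \<open>b * z\<close>.\<close>
  have "0 \<le> \<bar>b\<bar> / 2 * (1 + (if b < 0 then - z else z))\<^sup>2" by simp
  also have "\<dots> = \<bar>b\<bar> / 2 * (1 + z\<^sup>2) + b * z"
    by (simp add: power2_eq_square field_simps)
  finally have "0 \<le> \<bar>b\<bar> / 2 * (1 + z\<^sup>2) + b * z" .
  moreover have "0 \<le> z\<^sup>2 * poly (Poly ((c - \<bar>b\<bar> / 2) # cs)) z"
    using 4 by simp
  moreover have "\<bar>b\<bar> / 2 \<le> a" using 4 by simp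
  moreover have "poly (Poly (a # b # c # cs)) z =
      (a - \<bar>b\<bar> / 2) + (\<bar>b\<bar> / 2 * (1 + z\<^sup>2) + b * z) + z\<^sup>2 * poly (Poly ((c - \<bar>b\<bar> / 2) # cs)) z"
    by (simp add: power2_eq_square algebra_simps)
  ultimately show ?case
    by linarith
qed simp_all

text \<open>A nonnegative real polynomial is a sum of two squares. Rounding their coefficients
  leaves a small remainder \<open>cs\<close>, and its nonnegativity can be decided by evaluating
  \<open>dominated_odd\<close>.\<close>

lemma nonneg_if_squares_plus_dominated:
  assumes "P = a\<^sup>2 + b\<^sup>2 + Poly cs" and "dominated_odd cs"
  shows "0 \<le> poly P z"
  using dominated_odd_imp_nonneg[OF assms(2), of z] assms(1) by (simp add: poly_power)

subsection \<open>The change of the limiting risk\<close>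

text \<open>
  With \<open>g z = z / (1 + z\<^sup>2)\<close>, the numerator of \<open>g\<^sup>2 - 2 g' + 2 m g\<close> over \<open>(1 + z\<^sup>2)\<^sup>2\<close>. In units of the
  limiting variance, the change of the limiting risk is the Gaussian mean of this function for
  \<open>m = - \<mu> / \<sigma>\<close> and centre \<open>(\<mu> - h) / \<sigma>\<close>.
\<close>
definition risk_poly :: "real \<Rightarrow> real poly" where
  "risk_poly m = [:-2, 2 * m, 3, 2 * m:]"

definition risk_change :: "real \<Rightarrow> real \<Rightarrow> real" where
  "risk_change m k = gauss_mean k (\<lambda>z. poly (risk_poly m) z / (1 + z\<^sup>2)\<^sup>2)"

lemma degree_risk_poly: "degree (risk_poly m) \<le> 4"
  by (simp add: risk_poly_def)

lemma risk_change_le: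
  assumes "degree q < 2 * Suc j" and "\<And>z. 0 \<le> poly (slack_poly c (risk_poly m) j q k) z"
  shows "risk_change m k \<le> c"
  unfolding risk_change_def using assms degree_risk_poly by (intro gauss_mean_rational_le)

lemma risk_change_ge:
  assumes "degree q < 2 * Suc j" and "\<And>z. 0 \<le> poly (slack_poly (- c) (- risk_poly m) j q k) z"
  shows "c \<le> risk_change m k"
proof -
  have "gauss_mean k (\<lambda>z. poly (- risk_poly m) z / (1 + z\<^sup>2)\<^sup>2) \<le> - c"
    using assms degree_risk_poly by (intro gauss_mean_rational_le) simp_all
  then show ?thesis
    by (simp add: risk_change_def gauss_mean_def)
qed

text \<open>
  In the certificates below, \<open>q\<close> is a rounded solution of the linear program that minimizes the bound
  over all \<open>q\<close> of the given degree, and the two squares are a rounded spectral factorization of the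
  slack polynomial.
\<close>

lemma risk_change_dip: "risk_change (2/5) (-3/10) \<le> - 143/250"
proof (rule risk_change_le)
  let ?q = "[:-39/200, -37/25, -7/10, -81/20, -43/50, -723/200, -97/200, -141/200:] :: real poly"
  show "0 \<le> poly (slack_poly (- 143/250) (risk_poly (2/5)) 3 ?q (-3/10)) z" for z
  proof (rule nonneg_if_squares_plus_dominated)
    show "slack_poly (- 143/250) (risk_poly (2/5)) 3 ?q (-3/10) = [:0, 19/50, 7/50, -28/25, -7/50, 9/25:]\<^sup>2
        + [:-3/50, 1/50, 23/50, 1/50, -3/10:]\<^sup>2
        + Poly [29/10000, 7/5000, 89/10000, -21/2500, 181/5000, 31/10000, 453/10000, 43/5000, 73/10000, -27/10000, 17/5000]"
      by (simp add: slack_poly_def risk_poly_def pderiv_pCons eval_nat_numeral)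
  qed simp
qed simp

lemma risk_change_0_dip: "risk_change 0 (-3/10) \<le> - 451/1000"
proof (rule risk_change_le)
  let ?q = "[:3/20, -3/2, 1/5, -19/20:] :: real poly"
  show "0 \<le> poly (slack_poly (- 451/1000) (risk_poly 0) 1 ?q (-3/10)) z" for z
  proof (rule nonneg_if_squares_plus_dominated)
    show "slack_poly (- 451/1000) (risk_poly 0) 1 ?q (-3/10) = [:-57/1000, -347/500, 139/1000, 341/500:]\<^sup>2
        + [:-23/1000, -23/50, -287/1000, 183/1000:]\<^sup>2
        + Poly [111/500000, -69/250000, 22/15625, 29/500000, 143/500000, 223/500000, 387/1000000]"
      by (simp add: slack_poly_def risk_poly_def pderiv_pCons eval_nat_numeral)
  qed simp
qed simp

text \<open>Like \<open>risk_change_bump\<close>, this supplies a positive value: a continuous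
  function that vanishes at infinity attains its supremum once it is positive somewhere.\<close>

lemma risk_change_0_bump: "1/100 \<le> risk_change 0 3"
proof (rule risk_change_ge)
  let ?q = "[:3/5, 1, 1/5, -2/5:] :: real poly"
  show "0 \<le> poly (slack_poly (- (1/100)) (- risk_poly 0) 1 ?q 3) z" for z
  proof (rule nonneg_if_squares_plus_dominated)
    show "slack_poly (- (1/100)) (- risk_poly 0) 1 ?q 3 = [:-1/2, -11/10, 4/5, 3/10:]\<^sup>2
        + [:7/10, -1/2, -19/10, 1/2:]\<^sup>2
        + Poly [1/20, 0, 17/100, 3/50, 7/25, 1/50, 1/20]"
      by (simp add: slack_poly_def risk_poly_def pderiv_pCons eval_nat_numeral)
  qed simp
qed simp

lemma risk_change_bump: "1/100 \<le> risk_change (2/5) 3"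
proof (rule risk_change_ge)
  let ?q = "[:1, 1, 0, -1:] :: real poly"
  show "0 \<le> poly (slack_poly (- (1/100)) (- risk_poly (2/5)) 1 ?q 3) z" for z
  proof (rule nonneg_if_squares_plus_dominated)
    show "slack_poly (- (1/100)) (- risk_poly (2/5)) 1 ?q 3 = [:1/2, -17/10, 1/10, 4/5:]\<^sup>2
        + [:13/10, 1/5, -5/2, 1/2:]\<^sup>2
        + Poly [1/20, -1/50, 11/25, -4/25, 23/100, 7/50, 1/10]"
      by (simp add: slack_poly_def risk_poly_def pderiv_pCons eval_nat_numeral)
  qed simp
qed simp

text \<open>
  The slack polynomial is affine in \<open>k\<close> with slope \<open>q * (1 + z\<^sup>2)\<close>, so a certificate at a single \<open>k\<close> covers a
  half-line when \<open>q\<close> has constant sign, and two certificates with the same \<open>q\<close> cover an interval.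
\<close>
lemma risk_change_upper_bound: "risk_change (2/5) k \<le> 571/1000"
proof -
  \<comment> \<open>Each half-line gets a \<open>q\<close> of constant sign, nonpositive on the left
    and nonnegative on the right. The gap between them is covered by one \<open>q\<close> of varying
    sign, certified at both ends.\<close>
  consider "k \<le> 41/20" | "41/20 \<le> k" "k \<le> 53/20" | "53/20 \<le> k" by linarith
  then show ?thesis
  proof cases
    case 1
    let ?q = "[:-3/4, -19/20, -8/5, -29/10, -59/20, 2/5, -1/5:] :: real poly"
    have "0 \<le> poly (- ?q) z" for z
    proof (rule nonneg_if_squares_plus_dominated)
      show "- ?q = [:-3/10, -19/10, -3/5, 3/10:]\<^sup>2
          + [:7/10, -1/5, -19/10:]\<^sup>2
          + Poly [17/100, 9/100, 1/4, 1/25, 3/25, -1/25, 11/100]"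
        by (simp add: eval_nat_numeral)
    qed simp
    then have q: "poly ?q z \<le> 0" for z
      by (simp only: poly_minus neg_0_le_iff_le)
    have "0 \<le> poly (slack_poly (571/1000) (risk_poly (2/5)) 3 ?q (41/20)) z" for z
    proof (rule nonneg_if_squares_plus_dominated)
      show "slack_poly (571/1000) (risk_poly (2/5)) 3 ?q (41/20) = [:-1/500, 131/250, 39/50, -1233/500, -199/500, 377/500:]\<^sup>2
          + [:-143/500, -703/500, 203/50, 61/100, -403/250:]\<^sup>2
          + Poly [17/10000, 91/250000, 1441/125000, -1041/250000, 4133/250000, 371/62500, 4843/250000, -317/125000, 339/50000, 23/125000, 621/250000]"
        by (simp add: slack_poly_def risk_poly_def pderiv_pCons eval_nat_numeral)
    qed simp
    from slack_poly_antimono[OF 1 q this] show ?thesis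
      by (rule risk_change_le[rotated]) simp
  next
    case 2
    let ?q = "[:-71/100, -17/25, -19/10, -147/100, -117/100, -89/100, 6/25, 53/100:] :: real poly"
    have s: "0 \<le> poly (slack_poly (571/1000) (risk_poly (2/5)) 3 ?q (41/20)) z" for z
    proof (rule nonneg_if_squares_plus_dominated)
      show "slack_poly (571/1000) (risk_poly (2/5)) 3 ?q (41/20) = [:-23/100, 239/100, 93/40, -651/200, 3/25, 39/200:]\<^sup>2
          + [:-123/200, -121/100, 149/40, 38/25, -119/100:]\<^sup>2
          + Poly [7/1600, 71/10000, 191/20000, -21/5000, 281/20000, 1/20000, 539/40000, 81/20000, 319/20000, -3/10000, 119/40000]"
        by (simp add: slack_poly_def risk_poly_def pderiv_pCons eval_nat_numeral)
    qed simp
    have "0 \<le> poly (slack_poly (571/1000) (risk_poly (2/5)) 3 ?q (53/20)) z" for z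
    proof (rule nonneg_if_squares_plus_dominated)
      show "slack_poly (571/1000) (risk_poly (2/5)) 3 ?q (53/20) = [:1/50, 17/50, -9/100, -183/100, 109/100, 17/100:]\<^sup>2
          + [:-2/25, 4/25, 11/10, -33/25, -1/25, 1/10:]\<^sup>2
          + Poly [27/10000, 0, 69/10000, 37/10000, 29/1250, -43/5000, 77/2500, -6/625, 7/400, 19/10000, 21/10000]"
        by (simp add: slack_poly_def risk_poly_def pderiv_pCons eval_nat_numeral)
    qed simp
    from slack_poly_between[OF 2 s this] show ?thesis
      by (rule risk_change_le[rotated]) simp
  next
    case 3
    let ?q = "[:31/20, -6, 19, -351/10, 171/5, -391/20, 6:] :: real poly"
    have q: "0 \<le> poly ?q z" for z
    proof (rule nonneg_if_squares_plus_dominated)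
      show "?q = [:309/250, -1957/1000, -1431/1000, 2121/1000:]\<^sup>2
          + [:-7/50, 2071/500, -1101/200, 153/125:]\<^sup>2
          + Poly [169/62500, -317/125000, 10019/1000000, 1047/500000, 1149/125000, -1729/500000, 3183/1000000]"
        by (simp add: eval_nat_numeral)
    qed simp
    have "0 \<le> poly (slack_poly (571/1000) (risk_poly (2/5)) 3 ?q (53/20)) z" for z
    proof (rule nonneg_if_squares_plus_dominated)
      show "slack_poly (571/1000) (risk_poly (2/5)) 3 ?q (53/20) = [:-69/500, -1657/500, 197/100, 2849/500, -2259/500, 94/125:]\<^sup>2
          + [:81/100, 1987/500, -359/25, 5847/500, -251/100:]\<^sup>2
          + Poly [839/250000, -159/62500, 11037/250000, -2887/62500, 22791/250000, -2303/250000, 1321/62500, 5157/250000, 356/15625, -77/15625, 687/125000]"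
        by (simp add: slack_poly_def risk_poly_def pderiv_pCons eval_nat_numeral)
    qed simp
    from slack_poly_mono[OF 3 q this] show ?thesis
      by (rule risk_change_le[rotated]) simp
  qed
qed

text \<open>For \<open>m = 0\<close> no Stein correction is used (\<open>q = 0\<close>): the kernel
  \<open>(3 * z\<^sup>2 - 2) / (1 + z\<^sup>2)\<^sup>2\<close> has pointwise maximum 9/20, attained
  at \<open>z\<^sup>2 = 7/3\<close>.\<close>

lemma risk_change_0_upper_bound: "risk_change 0 k \<le> 9/20"
proof (rule risk_change_le)
  show "0 \<le> poly (slack_poly (9/20) (risk_poly 0) 0 0 k) z" for z
  proof -
    have "0 \<le> 9/20 * (z\<^sup>2 - 7/3)\<^sup>2" by simp
    also have "\<dots> = poly (slack_poly (9/20) (risk_poly 0) 0 0 k) z"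
      by (simp add: slack_poly_def risk_poly_def power2_eq_square field_simps)
    finally show ?thesis .
  qed
qed simp

section \<open>Dependence of the risk change on \<open>m\<close> and \<open>k\<close>:
  interpolation, symmetry, continuity and decay\<close>

lemma risk_kernel_bounded:
  obtains B where "\<And>z. \<bar>poly (risk_poly m) z / (1 + z\<^sup>2)\<^sup>2\<bar> \<le> B"
  using rational_bounded[of "risk_poly m" 2] degree_risk_poly[of m] by auto

lemma integrable_risk_kernel:
  "integrable std_normal_distribution (\<lambda>x. poly (risk_poly m) (k + x) / (1 + (k + x)\<^sup>2)\<^sup>2)"
proof -
  obtain B where B: "\<bar>poly (risk_poly m) z / (1 + z\<^sup>2)\<^sup>2\<bar> \<le> B" for z
    using risk_kernel_bounded[of m] by blast
  show ?thesis
    by (rule integrable_gauss_bounded[OF _ B])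
      (intro borel_measurable_continuous_onI continuous_on_rational)
qed

text \<open>The kernel is affine in \<open>m\<close>, hence so is its mean. For \<open>m\<close>
  between 0 and 2/5 this is a convex combination of the two endpoint values, so bounds at the
  endpoints suffice.\<close>

lemma risk_change_interpolate:
  "risk_change m k = (1 - 5/2 * m) * risk_change 0 k + 5/2 * m * risk_change (2/5) k"
proof -
  let ?g = "\<lambda>m x. poly (risk_poly m) (k + x) / (1 + (k + x)\<^sup>2)\<^sup>2"
  have "poly (risk_poly m) z = (1 - 5/2 * m) * poly (risk_poly 0) z + 5/2 * m * poly (risk_poly (2/5)) z" for z
    by (simp add: risk_poly_def algebra_simps)
  then have "?g m x = (1 - 5/2 * m) * ?g 0 x + 5/2 * m * ?g (2/5) x" for x
    by (simp add: add_divide_distrib)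
  then show ?thesis
    unfolding risk_change_def gauss_mean_def
    by (simp only: Bochner_Integration.integral_add integrable_mult_right integrable_risk_kernel
        integral_mult_right_zero)
qed

lemma distr_std_normal_uminus: "distr std_normal_distribution borel uminus = std_normal_distribution"
proof -
  have "distributed std_normal_distribution lborel (\<lambda>x. x) std_normal_density"
    by (simp add: distributed_def distr_id2)
  from std_normal.normal_density_affine[OF this, of "-1" 0]
  have "distributed std_normal_distribution lborel uminus std_normal_density"
    by simp
  then show ?thesis
    by (simp add: distributed_def cong: distr_cong)
qed

text \<open>The kernel is unchanged when \<open>m\<close> and its argument both change sign, and the
  standard normal law is symmetric.\<close>

lemma risk_change_uminus: "risk_change (- m) (- k) = risk_change m k"
proof -
  let ?g = "\<lambda>x. poly (risk_poly (- m)) (- k + x) / (1 + (- k + x)\<^sup>2)\<^sup>2"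
  have meas: "?g \<in> borel_measurable borel"
    using borel_measurable_integrable[OF integrable_risk_kernel[of "- m" "- k"]] by simp
  have "risk_change (- m) (- k) = (\<integral>x. ?g x \<partial>distr std_normal_distribution borel uminus)"
    by (simp add: risk_change_def gauss_mean_def distr_std_normal_uminus)
  also have "\<dots> = (\<integral>x. ?g (- x) \<partial>std_normal_distribution)"
    using meas by (intro integral_distr) simp_all
  also have "(\<lambda>x. ?g (- x)) = (\<lambda>x. poly (risk_poly m) (k + x) / (1 + (k + x)\<^sup>2)\<^sup>2)"
    by (rule ext) (simp add: risk_poly_def power2_eq_square algebra_simps)
  finally show ?thesis
    by (simp add: risk_change_def gauss_mean_def)
qed

text \<open>Dominated convergence with a constant bound for the kernel. It yields continuity when
  \<open>K\<close> converges and decay when \<open>K\<close> tends to infinity.\<close>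

lemma risk_change_tendsto:
  fixes l :: "real \<Rightarrow> real"
  assumes "\<And>x. (\<lambda>i. poly (risk_poly m) (K i + x) / (1 + (K i + x)\<^sup>2)\<^sup>2) \<longlonglongrightarrow> l x"
  shows "(\<lambda>i. risk_change m (K i)) \<longlonglongrightarrow> (\<integral>x. l x \<partial>std_normal_distribution)"
proof -
  obtain B where B: "\<bar>poly (risk_poly m) z / (1 + z\<^sup>2)\<^sup>2\<bar> \<le> B" for z
    using risk_kernel_bounded[of m] by blast
  have meas: "(\<lambda>x. poly (risk_poly m) (K i + x) / (1 + (K i + x)\<^sup>2)\<^sup>2)
      \<in> borel_measurable std_normal_distribution" for i
    using integrable_risk_kernel by (rule borel_measurable_integrable)
  show ?thesis
    unfolding risk_change_def gauss_mean_def
  proof (rule integral_dominated_convergence[where w = "\<lambda>_. B"])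
    show "l \<in> borel_measurable std_normal_distribution"
      using assms by (intro borel_measurable_LIMSEQ_real[OF _ meas]) auto
  qed (use assms B meas in auto)
qed

lemma isCont_risk_change: "isCont (risk_change m) k"
  unfolding continuous_at_sequentially
proof (intro allI impI)
  fix K :: "nat \<Rightarrow> real" assume K: "K \<longlonglongrightarrow> k"
  have "isCont (\<lambda>z. poly (risk_poly m) z / (1 + z\<^sup>2)\<^sup>2) z" for z
    using continuous_on_rational[of UNIV "risk_poly m" 2] by (simp add: continuous_on_eq_continuous_at)
  then have "(\<lambda>i. poly (risk_poly m) (K i + x) / (1 + (K i + x)\<^sup>2)\<^sup>2)
      \<longlonglongrightarrow> poly (risk_poly m) (k + x) / (1 + (k + x)\<^sup>2)\<^sup>2" for x
    by (rule isCont_tendsto_compose) (intro tendsto_intros K)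
  from risk_change_tendsto[OF this]
  show "(risk_change m \<circ> K) \<longlonglongrightarrow> risk_change m k"
    by (simp add: risk_change_def gauss_mean_def comp_def)
qed

lemma risk_change_at_top: "(risk_change m \<longlongrightarrow> 0) at_top"
proof (rule tendsto_at_topI_sequentially)
  fix K :: "nat \<Rightarrow> real" assume K: "filterlim K at_top sequentially"
  have "((\<lambda>z::real. (- 2 + 2 * m * z + 3 * z\<^sup>2 + 2 * m * z ^ 3) / (1 + z\<^sup>2)\<^sup>2) \<longlongrightarrow> 0) at_top"
    by real_asymp
  also have "(\<lambda>z::real. (- 2 + 2 * m * z + 3 * z\<^sup>2 + 2 * m * z ^ 3) / (1 + z\<^sup>2)\<^sup>2)
      = (\<lambda>z. poly (risk_poly m) z / (1 + z\<^sup>2)\<^sup>2)"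
    by (simp add: risk_poly_def fun_eq_iff algebra_simps eval_nat_numeral)
  finally have lim: "((\<lambda>z. poly (risk_poly m) z / (1 + z\<^sup>2)\<^sup>2) \<longlongrightarrow> 0) at_top" .
  have "filterlim (\<lambda>i. K i + x) at_top sequentially" for x
    using filterlim_tendsto_add_at_top[OF tendsto_const K, of x] by (simp add: add.commute)
  then have "(\<lambda>i. poly (risk_poly m) (K i + x) / (1 + (K i + x)\<^sup>2)\<^sup>2) \<longlonglongrightarrow> 0" for x
    using lim by (rule filterlim_compose[rotated])
  from risk_change_tendsto[OF this]
  show "(\<lambda>i. risk_change m (K i)) \<longlonglongrightarrow> 0"
    by simp
qed

lemma risk_change_at_bot: "(risk_change m \<longlongrightarrow> 0) at_bot"
proof -
  have "risk_change m (- k) = risk_change (- m) k" for k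
    using risk_change_uminus[of m "- k"] by simp
  then show ?thesis
    unfolding filterlim_at_bot_mirror using risk_change_at_top[of "- m"] by (simp only:)
qed

text \<open>Outside a compact interval \<open>f\<close> stays below \<open>f a\<close>, which forces
  \<open>a\<close> into the interval; the maximum over the interval is therefore global.\<close>

lemma attains_sup_if_vanishes_at_infinity:
  fixes f :: "real \<Rightarrow> real"
  assumes cont: "\<And>x. isCont f x" and "(f \<longlongrightarrow> 0) at_top" "(f \<longlongrightarrow> 0) at_bot" and "0 < f a"
  shows "\<exists>x. \<forall>y. f y \<le> f x"
proof -
  obtain M where M: "f x < f a" if "M \<le> x" for x
    using order_tendstoD(2)[OF assms(2,4)] by (auto simp: eventually_at_top_linorder)
  obtain N where N: "f x < f a" if "x \<le> N" for x
    using order_tendstoD(2)[OF assms(3,4)] by (auto simp: eventually_at_bot_linorder)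
  have a: "a \<in> {N..M}"
    using M[of a] N[of a] by (meson atLeastAtMost_iff less_irrefl linear)
  obtain x where x: "\<And>y. y \<in> {N..M} \<Longrightarrow> f y \<le> f x"
    using continuous_attains_sup[of "{N..M}" f] a cont
    by (metis compact_Icc continuous_at_imp_continuous_on empty_iff)
  have "f y \<le> f x" for y
    using x[of y] x[OF a] M[of y] N[of y] by (cases "y \<in> {N..M}") force+
  then show ?thesis by blast
qed

text \<open>For nonnegative \<open>m\<close>, the depth of the dip at the trial point -3/10 exceeds
  an upper bound valid for all centres. Negative \<open>m\<close> follows by reflection, which only
  replaces \<open>k\<close> by \<open>- k\<close>.\<close>

theorem risk_change_max_less_min:
  assumes "\<bar>m\<bar> \<le> 2/5"
  shows "\<exists>k1 k2. (\<forall>k. risk_change m k \<le> risk_change m k1) \<and> (\<forall>k. risk_change m k2 \<le> risk_change m k)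
    \<and> risk_change m k1 < - risk_change m k2"
proof -
  have nonneg: "\<exists>k1 k2. (\<forall>k. risk_change m k \<le> risk_change m k1) \<and> (\<forall>k. risk_change m k2 \<le> risk_change m k)
    \<and> risk_change m k1 < - risk_change m k2" if m: "0 \<le> m" "m \<le> 2/5" for m
  proof -
    define t where "t = 5/2 * m"
    have t: "0 \<le> t" "t \<le> 1" using m by (simp_all add: t_def)
    have eq: "risk_change m k = (1 - t) * risk_change 0 k + t * risk_change (2/5) k" for k
      unfolding t_def by (rule risk_change_interpolate)
    have upper: "risk_change m k \<le> (1 - t) * (9/20) + t * (571/1000)" for k
      unfolding eq using t
      by (intro add_mono mult_left_mono risk_change_0_upper_bound risk_change_upper_bound) auto
    have "risk_change m (-3/10) \<le> (1 - t) * (- 451/1000) + t * (- 143/250)"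
      unfolding eq using t
      by (intro add_mono mult_left_mono risk_change_0_dip risk_change_dip) auto
    \<comment> \<open>The comparison holds at both endpoints with margin 1/1000: 451/1000 against
      9/20, and 143/250 against 571/1000.\<close>
    also have "\<dots> < - ((1 - t) * (9/20) + t * (571/1000))"
      using t by (simp add: field_simps)
    finally have dip: "risk_change m (-3/10) < - ((1 - t) * (9/20) + t * (571/1000))" .
    have "(1 - t) * (1/100) + t * (1/100) \<le> risk_change m 3"
      unfolding eq using t
      by (intro add_mono mult_left_mono risk_change_0_bump risk_change_bump) auto
    then have "0 < risk_change m 3" by (simp add: field_simps)
    from attains_sup_if_vanishes_at_infinity[OF isCont_risk_change risk_change_at_top risk_change_at_bot this]
    obtain k1 where k1: "\<And>k. risk_change m k \<le> risk_change m k1" by blast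
    have "0 < - risk_change m (-3/10)"
      using dip t by (auto simp: field_simps)
    moreover have "((\<lambda>k. - risk_change m k) \<longlongrightarrow> 0) at_top" "((\<lambda>k. - risk_change m k) \<longlongrightarrow> 0) at_bot"
      using tendsto_minus[OF risk_change_at_top] tendsto_minus[OF risk_change_at_bot] by auto
    moreover have "isCont (\<lambda>k. - risk_change m k) k" for k
      by (intro continuous_intros isCont_risk_change)
    ultimately obtain k2 where k2: "\<And>k. - risk_change m k \<le> - risk_change m k2"
      using attains_sup_if_vanishes_at_infinity[of "\<lambda>k. - risk_change m k" "-3/10"] by blast
    have "risk_change m k1 < - risk_change m k2"
      using upper[of k1] dip k2[of "-3/10"] by linarith
    with k1 k2 show ?thesis by auto
  qed
  show ?thesis
  proof (cases "0 \<le> m")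
    case True
    with nonneg assms show ?thesis by simp
  next
    case False
    with assms have "0 \<le> - m" "- m \<le> 2/5" by auto
    from nonneg[OF this] obtain k1 k2 where
      k: "\<And>k. risk_change (- m) k \<le> risk_change (- m) k1" "\<And>k. risk_change (- m) k2 \<le> risk_change (- m) k"
        "risk_change (- m) k1 < - risk_change (- m) k2"
      by auto
    have flip: "risk_change (- m) k = risk_change m (- k)" for k
      using risk_change_uminus[of m "- k"] by simp
    have "risk_change m k \<le> risk_change m (- k1)" "risk_change m (- k2) \<le> risk_change m k" for k
      using k(1)[of "- k"] k(2)[of "- k"] by (simp_all add: flip)
    with k(3) show ?thesis by (auto simp: flip)
  qed
qed

subsection \<open>Convergence in probability and Slutsky's theorem\<close>

text \<open>If \<open>W\<close> is far from \<open>w\<close>, some member of the finite family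
  \<open>S\<close> misses its limit by more than \<open>\<delta>\<close>, and the union bound
  applies. This reduces Slutsky-type arguments to deterministic estimates; requiring them only
  eventually allows the growth of \<open>r\<close> to be used.\<close>

lemma conv_in_prob_if_close:
  fixes S :: "((nat \<Rightarrow> 'w \<Rightarrow> real) \<times> real) set"
  assumes prob: "\<And>n. prob_space (P n)" and fin: "finite S"
    and conv: "\<And>X a. (X, a) \<in> S \<Longrightarrow> conv_in_prob P X a"
    and meas: "\<And>X a n. (X, a) \<in> S \<Longrightarrow> X n \<in> borel_measurable (P n)"
    and close: "\<And>\<epsilon>. 0 < \<epsilon> \<Longrightarrow> \<exists>\<delta>>0. \<forall>\<^sub>F n in sequentially. \<forall>\<omega>\<in>space (P n).
      (\<forall>(X, a)\<in>S. \<bar>X n \<omega> - a\<bar> \<le> \<delta>) \<longrightarrow> \<bar>W n \<omega> - w\<bar> \<le> \<epsilon>"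
  shows "conv_in_prob P W w"
  unfolding conv_in_prob_def
proof (intro allI impI)
  fix \<epsilon> :: real assume "0 < \<epsilon>"
  from close[OF this] obtain \<delta> where \<delta>: "0 < \<delta>" and ev: "\<forall>\<^sub>F n in sequentially. \<forall>\<omega>\<in>space (P n).
      (\<forall>(X, a)\<in>S. \<bar>X n \<omega> - a\<bar> \<le> \<delta>) \<longrightarrow> \<bar>W n \<omega> - w\<bar> \<le> \<epsilon>"
    by blast
  define B where "B = (\<lambda>n (X, a). {\<omega>\<in>space (P n). \<bar>X n \<omega> - a\<bar> > \<delta>})"
  have sets: "B n p \<in> sets (P n)" if "p \<in> S" for n p
  proof -
    obtain X a where p: "p = (X, a)" by force
    have [measurable]: "X n \<in> borel_measurable (P n)" using meas that p by blast
    show ?thesis by (simp add: B_def p)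
  qed
  have "(\<lambda>n. measure (P n) (B n p)) \<longlonglongrightarrow> 0" if "p \<in> S" for p
    using that conv \<delta> by (cases p) (auto simp: B_def conv_in_prob_def)
  then have sum: "(\<lambda>n. \<Sum>p\<in>S. measure (P n) (B n p)) \<longlonglongrightarrow> 0"
    by (rule tendsto_null_sum)
  have "\<forall>\<^sub>F n in sequentially.
      measure (P n) {\<omega>\<in>space (P n). \<bar>W n \<omega> - w\<bar> > \<epsilon>} \<le> (\<Sum>p\<in>S. measure (P n) (B n p))"
    using ev
  proof eventually_elim
    case (elim n)
    interpret prob_space "P n" by (rule prob)
    have "{\<omega>\<in>space (P n). \<bar>W n \<omega> - w\<bar> > \<epsilon>} \<subseteq> (\<Union>p\<in>S. B n p)"
      using elim by (fastforce simp: B_def)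
    moreover have "(\<Union>p\<in>S. B n p) \<in> sets (P n)"
      using sets fin by (intro sets.finite_UN) auto
    ultimately have "prob {\<omega>\<in>space (P n). \<bar>W n \<omega> - w\<bar> > \<epsilon>} \<le> prob (\<Union>p\<in>S. B n p)"
      by (rule finite_measure_mono)
    also have "\<dots> \<le> (\<Sum>p\<in>S. prob (B n p))"
      using sets fin by (intro measure_UNION_le) auto
    finally show ?case .
  qed
  then show "(\<lambda>n. measure (P n) {\<omega>\<in>space (P n). \<bar>W n \<omega> - w\<bar> > \<epsilon>}) \<longlonglongrightarrow> 0"
    by (intro Lim_null_comparison[OF _ sum]) simp
qed

lemma conv_in_prob_mult_null:
  assumes prob: "\<And>n. prob_space (P n)" and "\<And>n. X n \<in> borel_measurable (P n)"
    and conv: "conv_in_prob P X a" and c: "c \<longlonglongrightarrow> 0"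
  shows "conv_in_prob P (\<lambda>n \<omega>. c n * X n \<omega>) 0"
proof (rule conv_in_prob_if_close[where S = "{(X, a)}"])
  fix \<epsilon> :: real assume "0 < \<epsilon>"
  define M where "M = \<bar>a\<bar> + 1"
  have "0 < M" by (simp add: M_def)
  have "\<forall>\<^sub>F n in sequentially. \<bar>c n\<bar> < \<epsilon> / M"
    using tendstoD[OF c, of "\<epsilon> / M"] \<open>0 < \<epsilon>\<close> \<open>0 < M\<close> by simp
  then have "\<forall>\<^sub>F n in sequentially. \<forall>\<omega>\<in>space (P n).
      (\<forall>(X, a)\<in>{(X, a)}. \<bar>X n \<omega> - a\<bar> \<le> 1) \<longrightarrow> \<bar>c n * X n \<omega> - 0\<bar> \<le> \<epsilon>"
  proof eventually_elim
    case (elim n)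
    have "\<bar>c n * X n \<omega>\<bar> \<le> \<epsilon>" if "\<bar>X n \<omega> - a\<bar> \<le> 1" for \<omega>
    proof -
      have "\<bar>c n\<bar> * \<bar>X n \<omega>\<bar> \<le> \<epsilon> / M * M"
        using elim that by (intro mult_mono) (auto simp: M_def)
      then show ?thesis using \<open>0 < M\<close> by (simp add: abs_mult)
    qed
    then show ?case by simp
  qed
  then show "\<exists>\<delta>>0. \<forall>\<^sub>F n in sequentially. \<forall>\<omega>\<in>space (P n).
      (\<forall>(X, a)\<in>{(X, a)}. \<bar>X n \<omega> - a\<bar> \<le> \<delta>) \<longrightarrow> \<bar>c n * X n \<omega> - 0\<bar> \<le> \<epsilon>"
    by (intro exI[of _ 1]) simp
qed (use assms in auto)

text \<open>A weakly convergent sequence is tight, so a vanishing factor sends it to 0 in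
  probability.\<close>

lemma conv_in_prob_scaled_null:
  fixes Q :: "real measure"
  assumes prob: "\<And>n. prob_space (P n)" and [measurable]: "\<And>n. Z n \<in> borel_measurable (P n)"
    and Q: "prob_space Q" "sets Q = sets borel"
    and weak: "weak_conv_borel (\<lambda>n. distr (P n) borel (Z n)) Q"
    and c: "c \<longlonglongrightarrow> 0"
  shows "conv_in_prob P (\<lambda>n \<omega>. c n * Z n \<omega>) 0"
  unfolding conv_in_prob_def
proof (intro allI impI)
  fix \<epsilon> :: real assume "0 < \<epsilon>"
  interpret Q: prob_space Q by fact
  \<comment> \<open>A continuous cut-off, 0 up to \<open>\<bar>x\<bar> = i\<close> and 1 from
    \<open>\<bar>x\<bar> = i + 1\<close> on: it dominates a tail indicator and is an admissible test
    function for weak convergence.\<close>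
  define f :: "nat \<Rightarrow> real \<Rightarrow> real" where "f = (\<lambda>i x. min 1 (max 0 (\<bar>x\<bar> - real i)))"
  have f_bounds: "0 \<le> f i x" "f i x \<le> 1" for i x by (auto simp: f_def)
  have f_cont: "continuous_on UNIV (f i)" for i
    unfolding f_def by (intro continuous_intros)
  then have f_meas: "f i \<in> borel_measurable borel" for i
    by (intro borel_measurable_continuous_onI)
  have f_Q: "(\<lambda>i. \<integral>x. f i x \<partial>Q) \<longlonglongrightarrow> (\<integral>x. 0 \<partial>Q)"
  proof (rule integral_dominated_convergence[where w = "\<lambda>_. 1"])
    have "(\<lambda>i. f i x) \<longlonglongrightarrow> 0" for x
    proof (rule tendsto_eventually)
      obtain j where "\<bar>x\<bar> \<le> real j" using real_arch_simple by blast
      then show "\<forall>\<^sub>F i in sequentially. f i x = 0"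
        by (intro eventually_sequentiallyI[of j]) (auto simp: f_def)
    qed
    then show "AE x in Q. (\<lambda>i. f i x) \<longlonglongrightarrow> 0" by simp
    show "f i \<in> borel_measurable Q" for i
      using f_meas Q(2) by (simp cong: measurable_cong_sets)
  qed (use f_bounds in auto)
  show "(\<lambda>n. measure (P n) {\<omega>\<in>space (P n). \<bar>c n * Z n \<omega> - 0\<bar> > \<epsilon>}) \<longlonglongrightarrow> 0"
  proof (rule LIMSEQ_I)
    fix \<eta> :: real assume "0 < \<eta>"
    from f_Q \<open>0 < \<eta>\<close> obtain i where i: "(\<integral>x. f i x \<partial>Q) < \<eta>"
      by (auto dest!: order_tendstoD(2) eventually_happens)
    have "(\<lambda>n. \<integral>x. f i x \<partial>distr (P n) borel (Z n)) \<longlonglongrightarrow> (\<integral>x. f i x \<partial>Q)"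
    proof -
      have "bounded (range (f i))"
        using f_bounds by (auto intro!: boundedI[of _ 1])
      with weak f_cont show ?thesis unfolding weak_conv_borel_def by blast
    qed
    then have ev1: "\<forall>\<^sub>F n in sequentially. (\<integral>x. f i x \<partial>distr (P n) borel (Z n)) < \<eta>"
      using i by (rule order_tendstoD)
    have ev2: "\<forall>\<^sub>F n in sequentially. \<bar>c n\<bar> < \<epsilon> / (real i + 1)"
      using tendstoD[OF c, of "\<epsilon> / (real i + 1)"] \<open>0 < \<epsilon>\<close> by (simp add: add_pos_nonneg)
    from ev1 ev2 have "\<forall>\<^sub>F n in sequentially.
        measure (P n) {\<omega>\<in>space (P n). \<bar>c n * Z n \<omega> - 0\<bar> > \<epsilon>} < \<eta>"
    proof eventually_elim
      case (elim n)
      interpret prob_space "P n" by (rule prob)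
      let ?A = "{\<omega>\<in>space (P n). \<bar>c n * Z n \<omega> - 0\<bar> > \<epsilon>}"
      have le: "indicator ?A \<omega> \<le> f i (Z n \<omega>)" for \<omega>
      proof (cases "\<omega> \<in> ?A")
        case True
        then have "\<epsilon> < \<bar>c n\<bar> * \<bar>Z n \<omega>\<bar>" by (simp add: abs_mult)
        also have "\<dots> \<le> \<epsilon> / (real i + 1) * \<bar>Z n \<omega>\<bar>"
          using elim by (intro mult_right_mono) auto
        finally have "\<epsilon> * 1 < \<epsilon> * (\<bar>Z n \<omega>\<bar> / (real i + 1))"
          by simp
        then have "real i + 1 < \<bar>Z n \<omega>\<bar>"
          using \<open>0 < \<epsilon>\<close> unfolding mult_less_cancel_left_pos[OF \<open>0 < \<epsilon>\<close>]
          by (simp add: less_divide_eq split: if_splits)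
        then show ?thesis using True by (simp add: f_def)
      qed (simp add: f_bounds)
      have "prob ?A = (\<integral>\<omega>. indicator ?A \<omega> \<partial>P n)"
        by simp
      also have "\<dots> \<le> (\<integral>\<omega>. f i (Z n \<omega>) \<partial>P n)"
      proof (rule integral_mono[OF _ _ le])
        show "integrable (P n) (\<lambda>\<omega>. f i (Z n \<omega>))"
          using f_bounds f_meas by (intro integrable_const_bound[of _ 1]) auto
      qed (simp add: less_top[symmetric])
      also have "\<dots> = (\<integral>x. f i x \<partial>distr (P n) borel (Z n))"
        using f_meas by (subst integral_distr) auto
      finally show ?case using elim by simp
    qed
    then show "\<exists>no. \<forall>n\<ge>no. norm (measure (P n) {\<omega>\<in>space (P n). \<bar>c n * Z n \<omega> - 0\<bar> > \<epsilon>} - 0) < \<eta>"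
      by (simp add: eventually_sequentially)
  qed
qed

text \<open>Continuous mapping and Slutsky in one, passing from \<open>weak_conv_borel\<close> to
  \<open>weak_conv_m\<close>. Testing against the continuous step functions is enough on the real
  line, and their uniform continuity absorbs the error \<open>T - u X\<close>.\<close>

lemma weak_conv_m_if_conv_in_prob:
  fixes u :: "real \<Rightarrow> real" and Q :: "real measure"
  assumes prob: "\<And>n. prob_space (P n)"
    and [measurable]: "\<And>n. X n \<in> borel_measurable (P n)" "\<And>n. T n \<in> borel_measurable (P n)"
    and Q: "prob_space Q" "sets Q = sets borel"
    and weak: "weak_conv_borel (\<lambda>n. distr (P n) borel (X n)) Q"
    and u: "continuous_on UNIV u"
    and conv: "conv_in_prob P (\<lambda>n \<omega>. T n \<omega> - u (X n \<omega>)) 0"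
  shows "weak_conv_m (\<lambda>n. distr (P n) borel (T n)) (distr Q borel u)"
proof (rule integral_cts_step_conv_imp_weak_conv)
  have [measurable]: "u \<in> borel_measurable borel"
    using u by (rule borel_measurable_continuous_onI)
  have uQ: "u \<in> borel_measurable Q"
    using Q(2) by (simp cong: measurable_cong_sets)
  show "real_distribution (distr (P n) borel (T n))" for n
    using prob[of n] by (simp add: real_distribution_def real_distribution_axioms_def prob_space.prob_space_distr)
  show "real_distribution (distr Q borel u)"
    using Q(1) uQ by (simp add: real_distribution_def real_distribution_axioms_def prob_space.prob_space_distr)
  fix x y :: real assume "x < y"
  define g where "g = cts_step x y"
  have g: "0 \<le> g t" "g t \<le> 1" for t using \<open>x < y\<close> by (auto simp: g_def cts_step_def)
  have unif: "uniformly_continuous_on UNIV g"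
    unfolding g_def using \<open>x < y\<close> by (rule cts_step_uniformly_continuous)
  then have g_cont: "continuous_on UNIV g" by (rule uniformly_continuous_imp_continuous)
  then have [measurable]: "g \<in> borel_measurable borel" by (rule borel_measurable_continuous_onI)
  have "(\<lambda>n. \<integral>t. g (u t) \<partial>distr (P n) borel (X n)) \<longlonglongrightarrow> (\<integral>t. g (u t) \<partial>Q)"
  proof -
    have "continuous_on UNIV (\<lambda>t. g (u t))"
      using g_cont u by (rule continuous_on_compose2) simp
    moreover have "bounded (range (\<lambda>t. g (u t)))"
      using g by (auto intro!: boundedI[of _ 1])
    ultimately show ?thesis using weak unfolding weak_conv_borel_def by blast
  qed
  then have main: "(\<lambda>n. \<integral>\<omega>. g (u (X n \<omega>)) \<partial>P n) \<longlonglongrightarrow> (\<integral>t. g (u t) \<partial>Q)"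
    by (simp add: integral_distr)
  have "(\<lambda>n. (\<integral>\<omega>. g (T n \<omega>) \<partial>P n) - (\<integral>\<omega>. g (u (X n \<omega>)) \<partial>P n)) \<longlonglongrightarrow> 0"
  proof (rule LIMSEQ_I)
    fix \<eta> :: real assume "0 < \<eta>"
    then obtain \<delta> where \<delta>: "0 < \<delta>" "\<And>s t. \<bar>s - t\<bar> < \<delta> \<Longrightarrow> \<bar>g s - g t\<bar> < \<eta> / 2"
      using unif unfolding uniformly_continuous_on_def dist_real_def
      by (metis UNIV_I half_gt_zero)
    define A where "A = (\<lambda>n. {\<omega>\<in>space (P n). \<bar>T n \<omega> - u (X n \<omega>) - 0\<bar> > \<delta> / 2})"
    have [measurable]: "A n \<in> sets (P n)" for n unfolding A_def by simp
    have "(\<lambda>n. measure (P n) (A n)) \<longlonglongrightarrow> 0"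
      using conv half_gt_zero[OF \<delta>(1)] unfolding conv_in_prob_def A_def by blast
    then have "\<forall>\<^sub>F n in sequentially. measure (P n) (A n) < \<eta> / 2"
      using \<open>0 < \<eta>\<close> by (intro order_tendstoD(2)) auto
    then have "\<forall>\<^sub>F n in sequentially.
        \<bar>(\<integral>\<omega>. g (T n \<omega>) \<partial>P n) - (\<integral>\<omega>. g (u (X n \<omega>)) \<partial>P n)\<bar> < \<eta>"
    proof eventually_elim
      case (elim n)
      interpret prob_space "P n" by (rule prob)
      have int: "integrable (P n) (\<lambda>\<omega>. g (T n \<omega>))" "integrable (P n) (\<lambda>\<omega>. g (u (X n \<omega>)))"
        using g by (auto intro!: integrable_const_bound[of _ 1])
      \<comment> \<open>On the exceptional event the two values in [0, 1] differ by at most 1. Off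
        it the error is at most \<open>\<delta> / 2\<close>, strictly below \<open>\<delta>\<close>,
        and uniform continuity applies.\<close>
      have le: "\<bar>g (T n \<omega>) - g (u (X n \<omega>))\<bar> \<le> \<eta> / 2 + indicator (A n) \<omega>" if "\<omega> \<in> space (P n)" for \<omega>
      proof (cases "\<omega> \<in> A n")
        case True
        then show ?thesis
          using g[of "T n \<omega>"] g[of "u (X n \<omega>)"] \<open>0 < \<eta>\<close> by (auto simp: abs_le_iff)
      next
        case False
        then have "\<bar>T n \<omega> - u (X n \<omega>)\<bar> < \<delta>" using that \<delta>(1) by (auto simp: A_def)
        with \<delta>(2) show ?thesis using False by (force intro: less_imp_le)
      qed
      have "\<bar>(\<integral>\<omega>. g (T n \<omega>) \<partial>P n) - (\<integral>\<omega>. g (u (X n \<omega>)) \<partial>P n)\<bar>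
          = \<bar>\<integral>\<omega>. g (T n \<omega>) - g (u (X n \<omega>)) \<partial>P n\<bar>"
        using int by simp
      also have "\<dots> \<le> (\<integral>\<omega>. \<bar>g (T n \<omega>) - g (u (X n \<omega>))\<bar> \<partial>P n)"
        by (rule integral_abs_bound)
      also have "\<dots> \<le> (\<integral>\<omega>. \<eta> / 2 + indicator (A n) \<omega> \<partial>P n)"
        using int le
        by (intro integral_mono Bochner_Integration.integrable_add integrable_const integrable_real_indicator)
          (auto simp: less_top[symmetric])
      also have "\<dots> = \<eta> / 2 + prob (A n)"
        by (subst Bochner_Integration.integral_add) (simp_all add: prob_space less_top[symmetric])
      finally show ?case using elim by simp
    qed
    then show "\<exists>no. \<forall>n\<ge>no. norm ((\<integral>\<omega>. g (T n \<omega>) \<partial>P n) - (\<integral>\<omega>. g (u (X n \<omega>)) \<partial>P n) - 0) < \<eta>"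
      by (simp add: eventually_sequentially)
  qed
  from tendsto_add[OF this main]
  show "(\<lambda>n. integral\<^sup>L (distr (P n) borel (T n)) (cts_step x y))
      \<longlonglongrightarrow> integral\<^sup>L (distr Q borel u) (cts_step x y)"
    using uQ by (simp add: integral_distr g_def[symmetric])
qed

lemma conv_in_prob_add_mult:
  assumes prob: "\<And>n. prob_space (P n)"
    and "\<And>n. X n \<in> borel_measurable (P n)" "\<And>n. Y n \<in> borel_measurable (P n)"
    and "conv_in_prob P X a" "conv_in_prob P Y b"
  shows "conv_in_prob P (\<lambda>n \<omega>. X n \<omega> + t * Y n \<omega>) (a + t * b)"
proof (rule conv_in_prob_if_close[where S = "{(X, a), (Y, b)}"])
  fix \<epsilon> :: real assume "0 < \<epsilon>"
  have close: "\<bar>x + t * y - (a + t * b)\<bar> \<le> \<epsilon>"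
    if "\<bar>x - a\<bar> \<le> \<epsilon> / (1 + \<bar>t\<bar>)" "\<bar>y - b\<bar> \<le> \<epsilon> / (1 + \<bar>t\<bar>)" for x y
  proof -
    have "\<bar>x + t * y - (a + t * b)\<bar> = \<bar>(x - a) + t * (y - b)\<bar>" by (simp add: algebra_simps)
    also have "\<dots> \<le> \<bar>x - a\<bar> + \<bar>t\<bar> * \<bar>y - b\<bar>" by (metis abs_mult abs_triangle_ineq)
    also have "\<dots> \<le> \<epsilon> / (1 + \<bar>t\<bar>) + \<bar>t\<bar> * (\<epsilon> / (1 + \<bar>t\<bar>))"
      using that by (intro add_mono mult_left_mono) auto
    also have "\<dots> = (1 + \<bar>t\<bar>) * (\<epsilon> / (1 + \<bar>t\<bar>))" by (simp only: distrib_right mult_1_left)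
    also have "\<dots> = \<epsilon>" by (simp add: add_pos_nonneg[THEN less_imp_neq, symmetric])
    finally show ?thesis .
  qed
  show "\<exists>\<delta>>0. \<forall>\<^sub>F n in sequentially. \<forall>\<omega>\<in>space (P n).
      (\<forall>(X, a)\<in>{(X, a), (Y, b)}. \<bar>X n \<omega> - a\<bar> \<le> \<delta>) \<longrightarrow> \<bar>X n \<omega> + t * Y n \<omega> - (a + t * b)\<bar> \<le> \<epsilon>"
    using close \<open>0 < \<epsilon>\<close> by (intro exI[of _ "\<epsilon> / (1 + \<bar>t\<bar>)"]) (simp add: add_pos_nonneg)
qed (use assms in auto)

text \<open>Eventual equality is the useful form here: identities that cancel
  \<open>sqrt (real n)\<close> may fail at \<open>n = 0\<close>.\<close>

lemma conv_in_prob_cong: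
  assumes "conv_in_prob P X a" and "\<forall>\<^sub>F n in sequentially. \<forall>\<omega>\<in>space (P n). X n \<omega> = Y n \<omega>"
  shows "conv_in_prob P Y a"
  unfolding conv_in_prob_def
proof (intro allI impI)
  fix \<epsilon> :: real assume "0 < \<epsilon>"
  with assms(1) have lim: "(\<lambda>n. measure (P n) {\<omega>\<in>space (P n). \<bar>X n \<omega> - a\<bar> > \<epsilon>}) \<longlonglongrightarrow> 0"
    by (simp add: conv_in_prob_def)
  have "\<forall>\<^sub>F n in sequentially. measure (P n) {\<omega>\<in>space (P n). \<bar>X n \<omega> - a\<bar> > \<epsilon>}
      = measure (P n) {\<omega>\<in>space (P n). \<bar>Y n \<omega> - a\<bar> > \<epsilon>}"
    using assms(2) by eventually_elim (intro arg_cong[where f = "measure _"] Collect_cong, auto)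
  with lim show "(\<lambda>n. measure (P n) {\<omega>\<in>space (P n). \<bar>Y n \<omega> - a\<bar> > \<epsilon>}) \<longlonglongrightarrow> 0"
    by (rule Lim_transform_eventually)
qed

subsection \<open>The estimator\<close>

text \<open>Makes the default values explicit, for measurability: if every \<open>p\<close> is a
  minimizer, or none is, the choice operator returns a constant independent of the sample
  point.\<close>

lemma mse_weight_cases:
  fixes D :: "'w estimation" and \<omega> :: 'w
  defines "a \<equiv> var_C D \<omega> - cov_CE D \<omega>"
    and "den \<equiv> (est_E D \<omega> - est_C D \<omega>)\<^sup>2 + (var_E D \<omega> + var_C D \<omega> - 2 * cov_CE D \<omega>)"
  shows "mse_weight D \<omega> = (if 0 < den then a / den
    else if den = 0 \<and> a = 0 then (SOME x. True) else (SOME x. False))"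
proof -
  let ?f = "empirical_mse D \<omega>"
  have f: "?f p = den * p\<^sup>2 - 2 * a * p + var_C D \<omega>" for p
    by (simp add: empirical_mse_def den_def a_def power2_eq_square algebra_simps)
  consider "0 < den" | "den = 0" "a = 0" | "den < 0 \<or> den = 0 \<and> a \<noteq> 0" by linarith
  then show ?thesis
  proof cases
    case 1
    then show ?thesis
      using mse_weight_eq[of D \<omega>] by (simp add: den_def a_def)
  next
    case 2
    then have "is_arg_min ?f (\<lambda>_. True) p" for p
      by (simp add: is_arg_min_def f)
    with 2 show ?thesis by (simp add: mse_weight_def arg_min_def)
  next
    case 3
    have "\<not> is_arg_min ?f (\<lambda>_. True) p" for p
    proof -
      \<comment> \<open>\<open>g\<close> is the derivative of the quadratic at \<open>p\<close>, and
        the unit step \<open>t\<close> goes in a direction of nonpositive slope, so it strictly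
        decreases a concave or nonconstant affine function.\<close>
      define g where "g = 2 * den * p - 2 * a"
      define t :: real where "t = (if g \<le> 0 then 1 else -1)"
      have "?f (p + t) - ?f p = den * t\<^sup>2 + t * g"
        by (simp add: f g_def power2_eq_square algebra_simps)
      also have "\<dots> < 0"
        using 3 by (auto simp: t_def g_def)
      finally have "?f (p + t) < ?f p" by simp
      then show ?thesis by (auto simp: is_arg_min_def)
    qed
    with 3 show ?thesis by (auto simp: mse_weight_def arg_min_def)
  qed
qed

lemma borel_measurable_est_MSE:
  assumes "valid_estimation D"
  shows "est_MSE D \<in> borel_measurable (sample_law D)"
proof -
  have [measurable]: "est_C D \<in> borel_measurable (sample_law D)" "est_E D \<in> borel_measurable (sample_law D)"
    "var_C D \<in> borel_measurable (sample_law D)" "var_E D \<in> borel_measurable (sample_law D)"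
    "cov_CE D \<in> borel_measurable (sample_law D)"
    using assms by (auto simp: valid_estimation_def)
  define a where "a = (\<lambda>\<omega>. var_C D \<omega> - cov_CE D \<omega>)"
  define den where "den = (\<lambda>\<omega>. (est_E D \<omega> - est_C D \<omega>)\<^sup>2 + (var_E D \<omega> + var_C D \<omega> - 2 * cov_CE D \<omega>))"
  have [measurable]: "a \<in> borel_measurable (sample_law D)" "den \<in> borel_measurable (sample_law D)"
    unfolding a_def den_def by measurable
  \<comment> \<open>The degenerate case is recast as a single inequality, which exhibits the weight
    as a piecewise measurable function.\<close>
  have zero: "(\<bar>x\<bar> + \<bar>y\<bar> \<le> 0) = (x = 0 \<and> y = 0)" for x y :: real by arith
  have "mse_weight D = (\<lambda>\<omega>. if 0 < den \<omega> then a \<omega> / den \<omega>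
      else if \<bar>den \<omega>\<bar> + \<bar>a \<omega>\<bar> \<le> 0 then (SOME x. True) else (SOME x. False))"
    unfolding mse_weight_cases[abs_def] zero a_def den_def ..
  also have "\<dots> \<in> borel_measurable (sample_law D)"
    by measurable
  finally have [measurable]: "mse_weight D \<in> borel_measurable (sample_law D)" .
  show ?thesis
    unfolding est_MSE_def[abs_def] by measurable
qed

text \<open>Numerator and denominator of the weight are both multiplied by \<open>r\<^sup>2\<close>,
  which expresses it through quantities at the scale where \<open>A\<close> and \<open>B\<close>
  converge.\<close>

lemma scaled_est_MSE_eq:
  fixes r b :: real and D :: "'w estimation" and \<omega> :: 'w
  defines "w \<equiv> r * (est_E D \<omega> - est_C D \<omega>)"
    and "A \<equiv> r\<^sup>2 * (var_C D \<omega> - cov_CE D \<omega>)"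
    and "B \<equiv> r\<^sup>2 * (var_E D \<omega> + var_C D \<omega> - 2 * cov_CE D \<omega>)"
  assumes r: "r \<noteq> 0" and pos: "0 < w\<^sup>2 + B"
  shows "r * (est_MSE D \<omega> - b) = r * (est_C D \<omega> - b) + A * w / (w\<^sup>2 + B)"
proof -
  define den where "den = (est_E D \<omega> - est_C D \<omega>)\<^sup>2 + (var_E D \<omega> + var_C D \<omega> - 2 * cov_CE D \<omega>)"
  have eq: "w\<^sup>2 + B = r\<^sup>2 * den"
    by (simp add: w_def B_def den_def power_mult_distrib distrib_left)
  then have "0 < den" using pos by (simp add: zero_less_mult_iff)
  then have "mse_weight D \<omega> = (var_C D \<omega> - cov_CE D \<omega>) / den"
    unfolding den_def by (rule mse_weight_eq)
  also have "\<dots> = A / (w\<^sup>2 + B)"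
    using r by (simp add: eq A_def)
  finally have weight: "mse_weight D \<omega> = A / (w\<^sup>2 + B)" .
  have "r * (est_MSE D \<omega> - b) = r * (est_C D \<omega> - b) + mse_weight D \<omega> * w"
    by (simp add: est_MSE_def w_def algebra_simps)
  then show ?thesis by (simp add: weight)
qed

lemma shrinkage_close:
  fixes s A B w w' \<delta> :: real
  assumes s: "0 < s" and \<delta>: "\<delta> \<le> s / 2" "\<bar>A - s\<bar> \<le> \<delta>" "\<bar>B - s\<bar> \<le> \<delta>" "\<bar>w - w'\<bar> \<le> \<delta>"
  shows "\<bar>A * w / (w\<^sup>2 + B) - s * w' / (w'\<^sup>2 + s)\<bar> \<le> (2 / sqrt s + 1) * \<delta>"
proof -
  define L where "L = 1 / sqrt s"
  have B: "s / 2 \<le> B" using \<delta> by linarith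
  have pos: "0 < w\<^sup>2 + B" "0 < w\<^sup>2 + s" "0 < w'\<^sup>2 + s"
    using s B by (auto intro: add_nonneg_pos)
  have "sqrt s * \<bar>w\<bar> \<le> w\<^sup>2 + B"
  proof -
    have "0 \<le> (\<bar>w\<bar> - sqrt s / 2)\<^sup>2" by simp
    also have "\<dots> = w\<^sup>2 - sqrt s * \<bar>w\<bar> + s / 4"
      using s by (simp add: power2_eq_square algebra_simps)
    finally show ?thesis using B s by linarith
  qed
  then have L: "\<bar>w\<bar> / (w\<^sup>2 + B) \<le> L"
    using s pos by (simp add: L_def divide_le_eq le_divide_eq mult.commute)
  have 1: "\<bar>A * w / (w\<^sup>2 + B) - s * w / (w\<^sup>2 + B)\<bar> \<le> L * \<delta>"
  proof -
    have "\<bar>A * w / (w\<^sup>2 + B) - s * w / (w\<^sup>2 + B)\<bar> = \<bar>w\<bar> / (w\<^sup>2 + B) * \<bar>A - s\<bar>"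
      using pos by (simp add: diff_divide_distrib[symmetric] left_diff_distrib[symmetric] abs_mult)
    also have "\<dots> \<le> L * \<delta>"
      using L \<delta> pos s by (intro mult_mono) (auto simp: L_def)
    finally show ?thesis .
  qed
  have 2: "\<bar>s * w / (w\<^sup>2 + B) - s * w / (w\<^sup>2 + s)\<bar> \<le> L * \<delta>"
  proof -
    have "s * w / (w\<^sup>2 + B) - s * w / (w\<^sup>2 + s) = w / (w\<^sup>2 + B) * ((s - B) * (s / (w\<^sup>2 + s)))"
      using pos by (simp add: field_simps)
    then have "\<bar>s * w / (w\<^sup>2 + B) - s * w / (w\<^sup>2 + s)\<bar>
        = \<bar>w\<bar> / (w\<^sup>2 + B) * (\<bar>B - s\<bar> * (s / (w\<^sup>2 + s)))"
      using pos s by (simp add: abs_mult abs_minus_commute)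
    also have "\<dots> \<le> L * (\<delta> * 1)"
      using L \<delta> pos s by (intro mult_mono) (auto simp: L_def)
    finally show ?thesis by simp
  qed
  have 3: "\<bar>s * w / (w\<^sup>2 + s) - s * w' / (w'\<^sup>2 + s)\<bar> \<le> \<delta>"
  proof -
    have "s * w / (w\<^sup>2 + s) - s * w' / (w'\<^sup>2 + s) = (w - w') * (s * (s - w * w') / ((w\<^sup>2 + s) * (w'\<^sup>2 + s)))"
      using pos by (simp add: divide_simps) (simp add: power2_eq_square algebra_simps)
    then have "\<bar>s * w / (w\<^sup>2 + s) - s * w' / (w'\<^sup>2 + s)\<bar>
        = \<bar>w - w'\<bar> * \<bar>s * (s - w * w') / ((w\<^sup>2 + s) * (w'\<^sup>2 + s))\<bar>"
      by (simp only: abs_mult)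
    moreover have "\<bar>s * (s - w * w')\<bar> \<le> (w\<^sup>2 + s) * (w'\<^sup>2 + s)"
    proof -
      have le: "\<bar>w\<bar> * \<bar>w'\<bar> \<le> w\<^sup>2 + w'\<^sup>2"
        using sum_squares_bound[of "\<bar>w\<bar>" "\<bar>w'\<bar>"] sum_power2_ge_zero[of w w']
        unfolding power2_abs by linarith
      have "\<bar>s * (s - w * w')\<bar> \<le> s * (s + \<bar>w\<bar> * \<bar>w'\<bar>)"
        using s abs_triangle_ineq4[of s "w * w'"] by (simp add: abs_mult)
      also have "s * (s + \<bar>w\<bar> * \<bar>w'\<bar>) \<le> s * (s + (w\<^sup>2 + w'\<^sup>2))"
        using s le by simp
      also have "\<dots> \<le> s * (s + (w\<^sup>2 + w'\<^sup>2)) + w\<^sup>2 * w'\<^sup>2"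
        by simp
      also have "\<dots> = (w\<^sup>2 + s) * (w'\<^sup>2 + s)"
        by (simp add: algebra_simps)
      finally show ?thesis .
    qed
    then have "\<bar>s * (s - w * w') / ((w\<^sup>2 + s) * (w'\<^sup>2 + s))\<bar> \<le> 1"
      using pos by (simp add: abs_mult)
    then have "\<bar>w - w'\<bar> * \<bar>s * (s - w * w') / ((w\<^sup>2 + s) * (w'\<^sup>2 + s))\<bar> \<le> \<delta> * 1"
      using \<delta>(4) by (intro mult_mono) auto
    ultimately show ?thesis by simp
  qed
  have "(2 / sqrt s + 1) * \<delta> = L * \<delta> + L * \<delta> + \<delta>"
    by (simp add: L_def algebra_simps)
  with 1 2 3 show ?thesis by linarith
qed

subsection \<open>Limits of the scaled estimators\<close>

lemma normal_law_eq_distr: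
  assumes "0 < v"
  shows "normal_law m v = distr std_normal_distribution borel (\<lambda>x. m + sqrt v * x)"
proof -
  have "distributed std_normal_distribution lborel (\<lambda>x. x) std_normal_density"
    by (simp add: distributed_def distr_id2)
  from std_normal.normal_density_affine[OF this, of "sqrt v" m] assms
  have "distributed std_normal_distribution lborel (\<lambda>x. m + sqrt v * x) (normal_density m (sqrt v))"
    by simp
  with assms show ?thesis
    by (simp add: distributed_def normal_law_def cong: distr_cong)
qed

lemma prob_space_normal_law: "0 < v \<Longrightarrow> prob_space (normal_law m v)"
  by (simp add: normal_law_def prob_space_normal_density)

lemma sets_normal_law: "sets (normal_law m v) = sets borel"
  by (simp add: normal_law_def)

lemma weak_conv_borel_continuous_image:
  fixes c :: "'a::topological_space \<Rightarrow> real"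
  assumes weak: "weak_conv_borel M N" and c: "continuous_on UNIV c"
    and M: "\<And>n. sets (M n) = sets borel" and N: "sets N = sets borel"
  shows "weak_conv_borel (\<lambda>n. distr (M n) borel c) (distr N borel c)"
  unfolding weak_conv_borel_def
proof (intro allI impI)
  fix f :: "real \<Rightarrow> real" assume f: "continuous_on UNIV f \<and> bounded (range f)"
  have [measurable]: "f \<in> borel_measurable borel"
    using f by (auto intro: borel_measurable_continuous_onI)
  have c_meas: "c \<in> borel_measurable borel"
    using c by (rule borel_measurable_continuous_onI)
  have "continuous_on UNIV (\<lambda>x. f (c x))"
    using f c by (auto intro: continuous_on_compose2[of UNIV f])
  moreover have "bounded (range (\<lambda>x. f (c x)))"
    using f by (auto intro: bounded_subset)
  ultimately have "(\<lambda>n. \<integral>x. f (c x) \<partial>M n) \<longlonglongrightarrow> (\<integral>x. f (c x) \<partial>N)"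
    using weak by (simp add: weak_conv_borel_def)
  moreover have "c \<in> measurable (M n) borel" "c \<in> measurable N borel" for n
    using c_meas M N by (simp_all cong: measurable_cong_sets)
  ultimately show "(\<lambda>n. \<integral>x. f x \<partial>distr (M n) borel c) \<longlonglongrightarrow> (\<integral>x. f x \<partial>distr N borel c)"
    by (simp add: integral_distr)
qed

text \<open>Every term involving \<open>E\<close> carries a power of
  \<open>r n / sqrt (real n)\<close>, which tends to 0: the first power in the centred estimator and
  the covariance, the square in the variance. Only the first marginal of the normal limit and
  \<open>sC2\<close> survive.\<close>

lemma asymptotic_setting_limits:
  fixes D :: "nat \<Rightarrow> 'w estimation"
  assumes setting: "asymptotic_setting \<mu> \<rho> sC2 sE2 r b0 bE D"
    and sC2: "0 < sC2" and r: "(\<lambda>n. r n / sqrt (real n)) \<longlonglongrightarrow> 0"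
  defines "P \<equiv> \<lambda>n. sample_law (D n)"
  shows "weak_conv_borel (\<lambda>n. distr (P n) borel (\<lambda>\<omega>. r n * (est_C (D n) \<omega> - b0 n))) (normal_law \<mu> sC2)"
    and "conv_in_prob P (\<lambda>n \<omega>. r n * (est_E (D n) \<omega> - bE n)) 0"
    and "conv_in_prob P (\<lambda>n \<omega>. (r n)\<^sup>2 * (var_C (D n) \<omega> - cov_CE (D n) \<omega>)) sC2"
    and "conv_in_prob P (\<lambda>n \<omega>. (r n)\<^sup>2 * (var_E (D n) \<omega> + var_C (D n) \<omega> - 2 * cov_CE (D n) \<omega>)) sC2"
proof -
  have valid: "valid_estimation (D n)" for n
    using setting by (simp add: asymptotic_setting_def)
  have prob: "prob_space (P n)" for n
    using valid[of n] by (simp add: valid_estimation_def P_def)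
  have meas [measurable]:
    "est_C (D n) \<in> borel_measurable (P n)" "est_E (D n) \<in> borel_measurable (P n)"
    "var_C (D n) \<in> borel_measurable (P n)" "var_E (D n) \<in> borel_measurable (P n)"
    "cov_CE (D n) \<in> borel_measurable (P n)" for n
    using valid[of n] by (auto simp: valid_estimation_def P_def)
  define X where "X = (\<lambda>n \<omega>. r n * (est_C (D n) \<omega> - b0 n))"
  define Y where "Y = (\<lambda>n \<omega>. sqrt (real n) * (est_E (D n) \<omega> - bE n))"
  have XY [measurable]: "X n \<in> borel_measurable (P n)" "Y n \<in> borel_measurable (P n)" for n
    unfolding X_def Y_def by measurable
  define V where "V = (\<lambda>n \<omega>. vector [X n \<omega>, Y n \<omega>] :: real ^ 2)"
  define S :: "real ^ 2 ^ 2" where "S = vector [vector [sC2, \<rho>], vector [\<rho>, sE2]]"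
  obtain N where N: "is_mv_normal (vector [\<mu>, 0] :: real ^ 2) S N"
      and weak: "weak_conv_borel (\<lambda>n. distr (P n) borel (V n)) N"
    using setting unfolding asymptotic_setting_def P_def V_def X_def Y_def S_def by blast
  have N_prob: "prob_space N" and N_sets: "sets N = sets borel"
    using N by (auto simp: is_mv_normal_def)
  have V_eq: "V n \<omega> = (\<chi> i. if i = 1 then X n \<omega> else Y n \<omega>)" for n \<omega>
    by (simp add: V_def vec_eq_iff forall_2 vector_2)
  have V [measurable]: "V n \<in> borel_measurable (P n)" for n
  proof -
    \<comment> \<open>The vector is expanded along the axes, which reduces its measurability to that
      of the two coordinates.\<close>
    have "(\<lambda>\<omega>. if i = (1::2) then X n \<omega> else Y n \<omega>) \<in> borel_measurable (P n)" for i
      by (cases "i = 1") simp_all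
    then have "(\<lambda>\<omega>. \<Sum>i\<in>UNIV. (if i = (1::2) then X n \<omega> else Y n \<omega>) *\<^sub>R (axis i 1 :: real ^ 2)) \<in> borel_measurable (P n)"
      by (intro borel_measurable_sum borel_measurable_scaleR borel_measurable_const)
    also have "(\<lambda>\<omega>. \<Sum>i\<in>UNIV. (if i = (1::2) then X n \<omega> else Y n \<omega>) *\<^sub>R (axis i 1 :: real ^ 2)) = V n"
      by (rule ext) (simp add: V_eq vec_eq_iff sum_2 forall_2 axis_def)
    finally show ?thesis .
  qed
  have image: "weak_conv_borel (\<lambda>n. distr (P n) borel (\<lambda>\<omega>. V n \<omega> $ i)) (distr N borel (\<lambda>x. x $ i))" for i
  proof -
    have c: "continuous_on UNIV (\<lambda>x::real^2. x $ i)"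
      by (intro continuous_intros)
    from weak_conv_borel_continuous_image[OF weak c _ N_sets]
    show ?thesis
      using borel_measurable_continuous_onI[OF c] by (simp add: distr_distr comp_def)
  qed
  \<comment> \<open>The first coordinate is a linear functional, so its law can be read off from
    \<open>is_mv_normal\<close> with \<open>t = axis 1 1\<close>.\<close>
  have e: "(axis 1 1 :: real ^ 2) \<bullet> x = x $ 1" for x
    by (simp add: inner_axis')
  have S11: "(S *v axis 1 1) $ 1 = sC2"
    by (simp add: S_def matrix_vector_mult_def sum_2 axis_def)
  have "distr N borel (\<lambda>x. axis 1 1 \<bullet> x) = normal_law (axis 1 1 \<bullet> (vector [\<mu>, 0] :: real ^ 2)) (axis 1 1 \<bullet> (S *v axis 1 1))"
    using N by (simp add: is_mv_normal_def)
  then have X_law: "distr N borel (\<lambda>x. x $ 1) = normal_law \<mu> sC2"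
    unfolding e S11 by simp
  show X_weak: "weak_conv_borel (\<lambda>n. distr (P n) borel (\<lambda>\<omega>. r n * (est_C (D n) \<omega> - b0 n))) (normal_law \<mu> sC2)"
    using image[of 1] by (simp add: X_law V_eq X_def)
  have proj: "(\<lambda>x. x $ 2) \<in> borel_measurable N"
    using N_sets borel_measurable_continuous_onI[of "\<lambda>x::real^2. x $ 2"]
    by (auto cong: measurable_cong_sets intro: continuous_intros)
  have "weak_conv_borel (\<lambda>n. distr (P n) borel (Y n)) (distr N borel (\<lambda>x. x $ 2))"
    using image[of 2] by (simp add: V_eq)
  from conv_in_prob_scaled_null[OF prob XY(2) _ _ this r]
  have "conv_in_prob P (\<lambda>n \<omega>. r n / sqrt (real n) * Y n \<omega>) 0"
    using prob_space.prob_space_distr[OF N_prob proj] by simp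
  then show "conv_in_prob P (\<lambda>n \<omega>. r n * (est_E (D n) \<omega> - bE n)) 0"
    by (rule conv_in_prob_cong, intro eventually_sequentiallyI[of 1]) (auto simp: Y_def)
  have VC: "conv_in_prob P (\<lambda>n \<omega>. (r n)\<^sup>2 * var_C (D n) \<omega>) sC2"
    and VE': "conv_in_prob P (\<lambda>n \<omega>. real n * var_E (D n) \<omega>) sE2"
    and cov': "conv_in_prob P (\<lambda>n \<omega>. sqrt (real n) * r n * cov_CE (D n) \<omega>) \<rho>"
    using setting by (simp_all add: asymptotic_setting_def P_def)
  have "conv_in_prob P (\<lambda>n \<omega>. (r n / sqrt (real n))\<^sup>2 * (real n * var_E (D n) \<omega>)) 0"
    using r by (intro conv_in_prob_mult_null[OF prob _ VE']) (auto intro: tendsto_null_power)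
  then have VE: "conv_in_prob P (\<lambda>n \<omega>. (r n)\<^sup>2 * var_E (D n) \<omega>) 0"
    by (rule conv_in_prob_cong, intro eventually_sequentiallyI[of 1]) (auto simp: power_divide)
  have "conv_in_prob P (\<lambda>n \<omega>. r n / sqrt (real n) * (sqrt (real n) * r n * cov_CE (D n) \<omega>)) 0"
    using r by (intro conv_in_prob_mult_null[OF prob _ cov']) auto
  then have cov: "conv_in_prob P (\<lambda>n \<omega>. (r n)\<^sup>2 * cov_CE (D n) \<omega>) 0"
    by (rule conv_in_prob_cong, intro eventually_sequentiallyI[of 1]) (auto simp: power2_eq_square)
  from conv_in_prob_add_mult[OF prob _ _ VC cov, of "-1"]
  show "conv_in_prob P (\<lambda>n \<omega>. (r n)\<^sup>2 * (var_C (D n) \<omega> - cov_CE (D n) \<omega>)) sC2"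
    by (simp add: right_diff_distrib)
  from conv_in_prob_add_mult[OF prob _ _ VC cov, of "-2"]
  have "conv_in_prob P (\<lambda>n \<omega>. (r n)\<^sup>2 * var_C (D n) \<omega> + - 2 * ((r n)\<^sup>2 * cov_CE (D n) \<omega>)) sC2"
    by simp
  from conv_in_prob_add_mult[OF prob _ _ this VE, of 1]
  show "conv_in_prob P (\<lambda>n \<omega>. (r n)\<^sup>2 * (var_E (D n) \<omega> + var_C (D n) \<omega> - 2 * cov_CE (D n) \<omega>)) sC2"
    by (simp add: algebra_simps)
qed

text \<open>The scaled estimator with random quantities replaced by limits: \<open>x\<close> stands
  for the limit of \<open>r n * (C - b0 n)\<close>, \<open>h - x\<close> for that of
  \<open>r n * (E - C)\<close>, and \<open>s\<close> for the limit of both \<open>A\<close> and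
  \<open>B\<close>.\<close>

definition mse_limit :: "real \<Rightarrow> real \<Rightarrow> real \<Rightarrow> real" where
  "mse_limit s h x = x + s * (h - x) / ((h - x)\<^sup>2 + s)"

lemma continuous_on_mse_limit: "0 < s \<Longrightarrow> continuous_on UNIV (mse_limit s h)"
  unfolding mse_limit_def [abs_def]
  by (intro continuous_intros) (metis add_nonneg_pos less_irrefl zero_le_power2)

lemma borel_measurable_mse_limit [measurable]: "0 < s \<Longrightarrow> mse_limit s h \<in> borel_measurable borel"
  by (intro borel_measurable_continuous_onI continuous_on_mse_limit)

text \<open>Common frame for fixed and local parameters, leaving only a deterministic estimate. The
  bound \<open>\<bar>x\<bar> \<le> r n * \<delta>\<close> reflects that \<open>X / r\<close> tends
  to 0 in probability; for fixed distinct parameters it keeps \<open>x\<close> from cancelling the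
  drift of \<open>w\<close>.\<close>

lemma scaled_MSE_weak_conv:
  fixes D :: "nat \<Rightarrow> 'w estimation"
  assumes setting: "asymptotic_setting \<mu> \<rho> sC2 sE2 r b0 bE D"
    and sC2: "0 < sC2" and r_top: "filterlim r at_top sequentially"
    and r_sqrt: "(\<lambda>n. r n / sqrt (real n)) \<longlonglongrightarrow> 0"
    and u: "continuous_on UNIV u"
    and close: "\<And>\<epsilon>. 0 < \<epsilon> \<Longrightarrow> \<exists>\<delta>>0. \<forall>\<^sub>F n in sequentially. \<forall>x y A B w.
      w = r n * (bE n - b0 n) + y - x \<longrightarrow> \<bar>x\<bar> \<le> r n * \<delta> \<longrightarrow> \<bar>y\<bar> \<le> \<delta> \<longrightarrow> \<bar>A - sC2\<bar> \<le> \<delta> \<longrightarrow> \<bar>B - sC2\<bar> \<le> \<delta>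
      \<longrightarrow> 0 < w\<^sup>2 + B \<and> \<bar>x + A * w / (w\<^sup>2 + B) - u x\<bar> \<le> \<epsilon>"
  shows "weak_conv_m (scaled_MSE_law r b0 D) (distr (normal_law \<mu> sC2) borel u)"
proof -
  define P where "P = (\<lambda>n. sample_law (D n))"
  have valid: "valid_estimation (D n)" for n
    using setting by (simp add: asymptotic_setting_def)
  have prob: "prob_space (P n)" for n
    using valid[of n] by (simp add: valid_estimation_def P_def)
  have [measurable]:
    "est_C (D n) \<in> borel_measurable (P n)" "est_E (D n) \<in> borel_measurable (P n)"
    "var_C (D n) \<in> borel_measurable (P n)" "var_E (D n) \<in> borel_measurable (P n)"
    "cov_CE (D n) \<in> borel_measurable (P n)" "est_MSE (D n) \<in> borel_measurable (P n)" for n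
    using valid[of n] borel_measurable_est_MSE[OF valid, of n] by (auto simp: valid_estimation_def P_def)
  define X where "X = (\<lambda>n \<omega>. r n * (est_C (D n) \<omega> - b0 n))"
  define Y where "Y = (\<lambda>n \<omega>. r n * (est_E (D n) \<omega> - bE n))"
  define A where "A = (\<lambda>n \<omega>. (r n)\<^sup>2 * (var_C (D n) \<omega> - cov_CE (D n) \<omega>))"
  define B where "B = (\<lambda>n \<omega>. (r n)\<^sup>2 * (var_E (D n) \<omega> + var_C (D n) \<omega> - 2 * cov_CE (D n) \<omega>))"
  define T where "T = (\<lambda>n \<omega>. r n * (est_MSE (D n) \<omega> - b0 n))"
  have meas [measurable]: "X n \<in> borel_measurable (P n)" "Y n \<in> borel_measurable (P n)" "A n \<in> borel_measurable (P n)"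
    "B n \<in> borel_measurable (P n)" "T n \<in> borel_measurable (P n)" for n
    unfolding X_def Y_def A_def B_def T_def by measurable
  have limits: "weak_conv_borel (\<lambda>n. distr (P n) borel (X n)) (normal_law \<mu> sC2)"
    "conv_in_prob P Y 0" "conv_in_prob P A sC2" "conv_in_prob P B sC2"
    using asymptotic_setting_limits[OF setting sC2 r_sqrt]
    by (simp_all only: P_def X_def Y_def A_def B_def)
  have X_null: "conv_in_prob P (\<lambda>n \<omega>. inverse (r n) * X n \<omega>) 0"
    using r_top
    by (intro conv_in_prob_scaled_null[OF prob meas(1) prob_space_normal_law[OF sC2] sets_normal_law limits(1)]
        tendsto_inverse_0_at_top)
  let ?S = "{(Y, 0), (A, sC2), (B, sC2), (\<lambda>n \<omega>. inverse (r n) * X n \<omega>, 0)}"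
  have "conv_in_prob P (\<lambda>n \<omega>. T n \<omega> - u (X n \<omega>)) 0"
  proof (rule conv_in_prob_if_close[where S = ?S])
    fix \<epsilon> :: real assume "0 < \<epsilon>"
    from close[OF this] obtain \<delta> where "0 < \<delta>" and
      ev: "\<forall>\<^sub>F n in sequentially. \<forall>x y A B w.
        w = r n * (bE n - b0 n) + y - x \<longrightarrow> \<bar>x\<bar> \<le> r n * \<delta> \<longrightarrow> \<bar>y\<bar> \<le> \<delta> \<longrightarrow> \<bar>A - sC2\<bar> \<le> \<delta> \<longrightarrow> \<bar>B - sC2\<bar> \<le> \<delta>
        \<longrightarrow> 0 < w\<^sup>2 + B \<and> \<bar>x + A * w / (w\<^sup>2 + B) - u x\<bar> \<le> \<epsilon>"
      by blast
    have "\<forall>\<^sub>F n in sequentially. 1 \<le> r n"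
      using r_top by (simp add: filterlim_at_top)
    with ev have "\<forall>\<^sub>F n in sequentially. \<forall>\<omega>\<in>space (P n).
        (\<forall>(X, a)\<in>?S. \<bar>X n \<omega> - a\<bar> \<le> \<delta>) \<longrightarrow> \<bar>T n \<omega> - u (X n \<omega>) - 0\<bar> \<le> \<epsilon>"
    proof eventually_elim
      case (elim n)
      have "\<bar>T n \<omega> - u (X n \<omega>)\<bar> \<le> \<epsilon>"
        if S: "\<bar>Y n \<omega>\<bar> \<le> \<delta>" "\<bar>A n \<omega> - sC2\<bar> \<le> \<delta>" "\<bar>B n \<omega> - sC2\<bar> \<le> \<delta>"
          and X: "\<bar>inverse (r n) * X n \<omega>\<bar> \<le> \<delta>" for \<omega>
      proof -
        define w where "w = r n * (est_E (D n) \<omega> - est_C (D n) \<omega>)"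
        have w: "w = r n * (bE n - b0 n) + Y n \<omega> - X n \<omega>"
          by (simp add: w_def X_def Y_def algebra_simps)
        have "\<bar>X n \<omega>\<bar> \<le> r n * \<delta>"
          using X elim(2) by (simp add: abs_mult field_simps)
        with elim(1) w S have pos: "0 < w\<^sup>2 + B n \<omega>"
          and le: "\<bar>X n \<omega> + A n \<omega> * w / (w\<^sup>2 + B n \<omega>) - u (X n \<omega>)\<bar> \<le> \<epsilon>"
          by blast+
        have "T n \<omega> = X n \<omega> + A n \<omega> * w / (w\<^sup>2 + B n \<omega>)"
          using scaled_est_MSE_eq[of "r n" "D n" \<omega> "b0 n"] pos elim(2)
          by (simp add: T_def X_def A_def B_def w_def)
        with le show ?thesis by simp
      qed
      then show ?case by simp
    qed
    with \<open>0 < \<delta>\<close> show "\<exists>\<delta>>0. \<forall>\<^sub>F n in sequentially. \<forall>\<omega>\<in>space (P n).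
        (\<forall>(X, a)\<in>?S. \<bar>X n \<omega> - a\<bar> \<le> \<delta>) \<longrightarrow> \<bar>T n \<omega> - u (X n \<omega>) - 0\<bar> \<le> \<epsilon>"
      by blast
  qed (use limits(2-4) X_null prob in auto)
  from weak_conv_m_if_conv_in_prob[OF prob meas(1,5) prob_space_normal_law[OF sC2] sets_normal_law
      limits(1) u this]
  show ?thesis
    by (simp add: scaled_MSE_law_def[abs_def] T_def P_def)
qed

lemma scaled_MSE_weak_conv_fixed:
  fixes D :: "nat \<Rightarrow> 'w estimation"
  assumes setting: "asymptotic_setting \<mu> \<rho> sC2 sE2 r (\<lambda>_. b0) (\<lambda>_. bE) D" and "b0 \<noteq> bE"
    and sC2: "0 < sC2" and r_top: "filterlim r at_top sequentially"
    and r_sqrt: "(\<lambda>n. r n / sqrt (real n)) \<longlonglongrightarrow> 0"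
  shows "weak_conv_m (scaled_MSE_law r (\<lambda>_. b0) D) (normal_law \<mu> sC2)"
proof -
  define \<Delta> where "\<Delta> = \<bar>bE - b0\<bar>"
  have "0 < \<Delta>" using \<open>b0 \<noteq> bE\<close> by (simp add: \<Delta>_def)
  \<comment> \<open>With \<open>\<Delta> / 4\<close>, the terms \<open>x\<close> and
    \<open>y\<close> together take away at most half of the drift \<open>r n * \<Delta>\<close>;
    with \<open>sC2\<close>, \<open>B\<close> is nonnegative and
    \<open>\<bar>A\<bar> \<le> 2 * sC2\<close>.\<close>
  define \<delta> where "\<delta> = min (\<Delta> / 4) sC2"
  have \<delta>: "0 < \<delta>" "\<delta> \<le> \<Delta> / 4" "\<delta> \<le> sC2" using \<open>0 < \<Delta>\<close> sC2 by (auto simp: \<delta>_def)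
  have "weak_conv_m (scaled_MSE_law r (\<lambda>_. b0) D) (distr (normal_law \<mu> sC2) borel (\<lambda>x. x))"
  proof (rule scaled_MSE_weak_conv[OF setting sC2 r_top r_sqrt continuous_on_id], rule exI[of _ \<delta>], rule conjI[OF \<delta>(1)])
    fix \<epsilon> :: real assume "0 < \<epsilon>"
    \<comment> \<open>The second threshold makes the final bound
      \<open>4 * sC2 / (r n * \<Delta>)\<close> on the correction at most
      \<open>\<epsilon>\<close>.\<close>
    have "\<forall>\<^sub>F n in sequentially. max 1 (4 * sC2 / (\<epsilon> * \<Delta>)) \<le> r n"
      using r_top unfolding filterlim_at_top by blast
    then show "\<forall>\<^sub>F n in sequentially. \<forall>x y A B w. w = r n * (bE - b0) + y - x
      \<longrightarrow> \<bar>x\<bar> \<le> r n * \<delta> \<longrightarrow> \<bar>y\<bar> \<le> \<delta> \<longrightarrow> \<bar>A - sC2\<bar> \<le> \<delta> \<longrightarrow> \<bar>B - sC2\<bar> \<le> \<delta>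
      \<longrightarrow> 0 < w\<^sup>2 + B \<and> \<bar>x + A * w / (w\<^sup>2 + B) - x\<bar> \<le> \<epsilon>"
    proof eventually_elim
      case (elim n)
      then have r1: "1 \<le> r n" and r2: "4 * sC2 \<le> r n * (\<epsilon> * \<Delta>)"
        using \<open>0 < \<epsilon>\<close> \<open>0 < \<Delta>\<close> by (simp_all add: divide_le_eq)
      show ?case
      proof (intro allI impI)
        fix x y A B w :: real
        assume w_eq: "w = r n * (bE - b0) + y - x" and x: "\<bar>x\<bar> \<le> r n * \<delta>" and y: "\<bar>y\<bar> \<le> \<delta>"
          and A: "\<bar>A - sC2\<bar> \<le> \<delta>" and B: "\<bar>B - sC2\<bar> \<le> \<delta>"
        have "\<delta> \<le> r n * \<delta>" using r1 \<delta> by simp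
        moreover have "r n * \<delta> \<le> r n * (\<Delta> / 4)" using r1 \<delta> by (intro mult_left_mono) auto
        moreover have "\<bar>r n * (bE - b0)\<bar> = r n * \<Delta>" using r1 by (simp add: \<Delta>_def abs_mult)
        ultimately have w: "r n * \<Delta> / 2 \<le> \<bar>w\<bar>"
          using x y unfolding w_eq by linarith
        have "0 < r n * \<Delta>" using r1 \<open>0 < \<Delta>\<close> by simp
        with w have "w \<noteq> 0" by auto
        have "0 \<le> B" using B \<delta> by linarith
        then have pos: "0 < w\<^sup>2 + B" using \<open>w \<noteq> 0\<close> by (simp add: add_pos_nonneg)
        have "\<bar>x + A * w / (w\<^sup>2 + B) - x\<bar> = \<bar>A\<bar> * (\<bar>w\<bar> / (w\<^sup>2 + B))"
          using pos by (simp add: abs_mult)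
        also have "\<dots> \<le> (2 * sC2) * (2 / (r n * \<Delta>))"
        proof (intro mult_mono)
          show "\<bar>A\<bar> \<le> 2 * sC2" using A \<delta> sC2 by linarith
          have "\<bar>w\<bar> / (w\<^sup>2 + B) \<le> \<bar>w\<bar> / w\<^sup>2"
            using \<open>0 \<le> B\<close> \<open>w \<noteq> 0\<close> pos by (intro divide_left_mono) auto
          also have "\<dots> = 1 / \<bar>w\<bar>"
            using \<open>w \<noteq> 0\<close> by (simp add: power2_eq_square divide_simps)
          also have "\<dots> \<le> 1 / (r n * \<Delta> / 2)"
            using w \<open>0 < r n * \<Delta>\<close> by (intro divide_left_mono) auto
          finally show "\<bar>w\<bar> / (w\<^sup>2 + B) \<le> 2 / (r n * \<Delta>)" by simp
        qed (use sC2 pos in auto)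
        also have "\<dots> \<le> \<epsilon>"
          using r2 \<open>0 < r n * \<Delta>\<close> by (simp add: divide_le_eq ac_simps)
        finally show "0 < w\<^sup>2 + B \<and> \<bar>x + A * w / (w\<^sup>2 + B) - x\<bar> \<le> \<epsilon>"
          using pos by simp
      qed
    qed
  qed
  then show ?thesis
    by (simp add: distr_id2 sets_normal_law)
qed

lemma scaled_MSE_weak_conv_local:
  fixes D :: "nat \<Rightarrow> 'w estimation"
  assumes setting: "asymptotic_setting \<mu> \<rho> sC2 sE2 r b0 (\<lambda>n. b0 n + h / r n) D"
    and sC2: "0 < sC2" and r_top: "filterlim r at_top sequentially"
    and r_sqrt: "(\<lambda>n. r n / sqrt (real n)) \<longlonglongrightarrow> 0"
  shows "weak_conv_m (scaled_MSE_law r b0 D) (distr (normal_law \<mu> sC2) borel (mse_limit sC2 h))"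
proof (rule scaled_MSE_weak_conv[OF setting sC2 r_top r_sqrt continuous_on_mse_limit[OF sC2]])
  fix \<epsilon> :: real assume "0 < \<epsilon>"
  \<comment> \<open>The constant of \<open>shrinkage_close\<close>, applied with
    \<open>w' = h - x\<close>; the drift \<open>r n * (h / r n)\<close> equals
    \<open>h\<close>.\<close>
  define L where "L = 2 / sqrt sC2 + 1"
  have L: "0 < L" using sC2 by (simp add: L_def add_pos_pos)
  define \<delta> where "\<delta> = min (sC2 / 2) (\<epsilon> / L)"
  have \<delta>: "0 < \<delta>" "\<delta> \<le> sC2 / 2" "L * \<delta> \<le> \<epsilon>"
    using sC2 L \<open>0 < \<epsilon>\<close> by (auto simp: \<delta>_def min_def field_simps)
  have "\<forall>\<^sub>F n in sequentially. 1 \<le> r n"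
    using r_top by (simp add: filterlim_at_top)
  then have "\<forall>\<^sub>F n in sequentially. \<forall>x y A B w. w = r n * (b0 n + h / r n - b0 n) + y - x
    \<longrightarrow> \<bar>x\<bar> \<le> r n * \<delta> \<longrightarrow> \<bar>y\<bar> \<le> \<delta> \<longrightarrow> \<bar>A - sC2\<bar> \<le> \<delta> \<longrightarrow> \<bar>B - sC2\<bar> \<le> \<delta>
    \<longrightarrow> 0 < w\<^sup>2 + B \<and> \<bar>x + A * w / (w\<^sup>2 + B) - mse_limit sC2 h x\<bar> \<le> \<epsilon>"
  proof eventually_elim
    case (elim n)
    show ?case
    proof (intro allI impI)
      fix x y A B w :: real
      assume w: "w = r n * (b0 n + h / r n - b0 n) + y - x" and y: "\<bar>y\<bar> \<le> \<delta>"
        and A: "\<bar>A - sC2\<bar> \<le> \<delta>" and B: "\<bar>B - sC2\<bar> \<le> \<delta>"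
      have "\<bar>w - (h - x)\<bar> \<le> \<delta>"
        using y elim by (simp add: w)
      from shrinkage_close[OF sC2 \<delta>(2) A B this] \<delta>(3)
      have "\<bar>x + A * w / (w\<^sup>2 + B) - mse_limit sC2 h x\<bar> \<le> \<epsilon>"
        by (simp add: L_def mse_limit_def)
      moreover have "0 < B" using B \<delta> sC2 by linarith
      ultimately show "0 < w\<^sup>2 + B \<and> \<bar>x + A * w / (w\<^sup>2 + B) - mse_limit sC2 h x\<bar> \<le> \<epsilon>"
        by (simp add: add_nonneg_pos)
    qed
  qed
  with \<delta>(1) show "\<exists>\<delta>>0. \<forall>\<^sub>F n in sequentially. \<forall>x y A B w. w = r n * (b0 n + h / r n - b0 n) + y - x
    \<longrightarrow> \<bar>x\<bar> \<le> r n * \<delta> \<longrightarrow> \<bar>y\<bar> \<le> \<delta> \<longrightarrow> \<bar>A - sC2\<bar> \<le> \<delta> \<longrightarrow> \<bar>B - sC2\<bar> \<le> \<delta>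
    \<longrightarrow> 0 < w\<^sup>2 + B \<and> \<bar>x + A * w / (w\<^sup>2 + B) - mse_limit sC2 h x\<bar> \<le> \<epsilon>"
    by blast
qed

subsection \<open>Second moments of the limits\<close>

lemma std_normal_affine_square:
  "integrable std_normal_distribution (\<lambda>x. (a + b * x)\<^sup>2)"
  "(\<integral>x. (a + b * x)\<^sup>2 \<partial>std_normal_distribution) = a\<^sup>2 + b\<^sup>2"
proof -
  have eq: "(a + b * x)\<^sup>2 = a\<^sup>2 + (2 * a * b) * x + b\<^sup>2 * x\<^sup>2" for x :: real
    by (simp add: power2_eq_square algebra_simps)
  have int: "integrable std_normal_distribution (\<lambda>x. x)" "integrable std_normal_distribution (\<lambda>x. x\<^sup>2)"
    using integrable_std_normal_distribution_moment[of 1] integrable_std_normal_distribution_moment[of 2]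
    by simp_all
  then show "integrable std_normal_distribution (\<lambda>x. (a + b * x)\<^sup>2)"
    unfolding eq by simp
  have "(\<integral>x. x \<partial>std_normal_distribution) = 0" "(\<integral>x. x\<^sup>2 \<partial>std_normal_distribution) = 1"
    using integral_std_normal_distribution_moment_odd[of 1] std_normal_distribution_even_moments(1)[of 1]
    by simp_all
  then show "(\<integral>x. (a + b * x)\<^sup>2 \<partial>std_normal_distribution) = a\<^sup>2 + b\<^sup>2"
    unfolding eq using int std_normal.prob_space by simp
qed

lemma normal_law_second_moment:
  assumes "0 < s"
  shows "integrable (normal_law \<mu> s) (\<lambda>x. x\<^sup>2)" "(\<integral>x. x\<^sup>2 \<partial>normal_law \<mu> s) = \<mu>\<^sup>2 + s"
  using assms std_normal_affine_square[of \<mu> "sqrt s"]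
  by (simp_all add: normal_law_eq_distr integrable_distr_eq integral_distr)

text \<open>With \<open>z = (V - h) / \<sigma>\<close> and \<open>g z = z / (1 + z\<^sup>2)\<close>,
  squaring changes \<open>V\<^sup>2\<close> by \<open>s * (g\<^sup>2 - 2 * (m + z - k) * g)\<close>.
  Stein's identity replaces \<open>(z - k) * g\<close> by \<open>g'\<close> in the mean, leaving the
  risk kernel; \<open>m\<close> is \<open>\<mu> / \<sigma>\<close> in the proof, so the kernel has
  parameter \<open>- m\<close>.\<close>

lemma mse_limit_second_moment:
  assumes s: "0 < s"
  shows "integrable (normal_law \<mu> s) (\<lambda>x. (mse_limit s h x)\<^sup>2)"
    "(\<integral>x. (mse_limit s h x)\<^sup>2 \<partial>normal_law \<mu> s)
      = \<mu>\<^sup>2 + s + s * risk_change (- (\<mu> / sqrt s)) ((\<mu> - h) / sqrt s)"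
proof -
  define \<sigma> where "\<sigma> = sqrt s"
  have \<sigma>: "0 < \<sigma>" "\<sigma>\<^sup>2 = s" using s by (simp_all add: \<sigma>_def)
  define m where "m = \<mu> / \<sigma>"
  define k where "k = (\<mu> - h) / \<sigma>"
  \<comment> \<open>The numerator of \<open>(z - k) * g z - g' z\<close>, so that \<open>G\<close>
    has mean 0.\<close>
  define q where "q = [:-1, -k, 2, -k, 1:]"
  define K where "K = (\<lambda>x. poly (risk_poly (- m)) (k + x) / (1 + (k + x)\<^sup>2)\<^sup>2)"
  define G where "G = (\<lambda>x. poly q (k + x) / (1 + (k + x)\<^sup>2)\<^sup>2)"
  have eq: "(mse_limit s h (\<mu> + \<sigma> * x))\<^sup>2 = (\<mu> + \<sigma> * x)\<^sup>2 + s * (K x - 2 * G x)" for x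
  proof -
    define z where "z = k + x"
    define W where "W = 1 + z\<^sup>2"
    have W: "W \<noteq> 0" using one_plus_square_pos[of z] by (simp add: W_def)
    have X: "\<mu> + \<sigma> * x = \<sigma> * (m + z - k)" and hX: "h - (\<mu> + \<sigma> * x) = - (\<sigma> * z)"
      using \<sigma>(1) by (simp_all add: m_def k_def z_def field_simps)
    have "(h - (\<mu> + \<sigma> * x))\<^sup>2 + s = s * W"
      unfolding hX W_def \<sigma>(2)[symmetric] by (simp add: power2_eq_square algebra_simps)
    then have "mse_limit s h (\<mu> + \<sigma> * x) = \<sigma> * (m + z - k) - \<sigma> * (z / W)"
      unfolding mse_limit_def hX X[symmetric] using s by simp
    then have "(mse_limit s h (\<mu> + \<sigma> * x))\<^sup>2
        = (\<sigma> * (m + z - k))\<^sup>2 + \<sigma>\<^sup>2 * ((z / W)\<^sup>2 - 2 * (m + z - k) * (z / W))"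
      by (simp only:) (simp add: power2_eq_square algebra_simps)
    moreover have "(z / W)\<^sup>2 - 2 * (m + z - k) * (z / W) = K x - 2 * G x"
    proof -
      have "(z / W)\<^sup>2 - 2 * (m + z - k) * (z / W) = (z\<^sup>2 - 2 * (m + z - k) * (z * W)) / W\<^sup>2"
        using W by (simp add: power2_eq_square diff_divide_distrib)
      also have "z\<^sup>2 - 2 * (m + z - k) * (z * W) = poly (risk_poly (- m)) z - 2 * poly q z"
        by (simp add: risk_poly_def q_def W_def power2_eq_square algebra_simps)
      finally show ?thesis
        by (simp add: K_def G_def z_def W_def diff_divide_distrib)
    qed
    ultimately show ?thesis by (simp add: X \<sigma>)
  qed
  have intK: "integrable std_normal_distribution K"
    unfolding K_def by (rule integrable_risk_kernel)
  have "degree q \<le> 2 * 2" by (simp add: q_def)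
  from rational_bounded[OF this] obtain B where B: "\<bar>poly q z / (1 + z\<^sup>2)\<^sup>2\<bar> \<le> B" for z
    by blast
  have intG: "integrable std_normal_distribution G"
    unfolding G_def
    by (rule integrable_gauss_bounded[OF _ B]) (intro borel_measurable_continuous_onI continuous_on_rational)
  have "(\<integral>x. G x \<partial>std_normal_distribution) = gauss_mean k (\<lambda>z. poly q z / (1 + z\<^sup>2)\<^sup>2)"
    by (simp add: G_def gauss_mean_def)
  also have "(\<lambda>z. poly q z / (1 + z\<^sup>2)\<^sup>2) = (\<lambda>z. (((z - k) * poly [:0, 1:] z - poly (pderiv [:0, 1:]) z) * (1 + z\<^sup>2)
      + 2 * real (Suc 0) * z * poly [:0, 1:] z) / (1 + z\<^sup>2) ^ (0 + 2))"
    by (rule ext) (simp add: q_def pderiv_pCons power2_eq_square algebra_simps)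
  also have "gauss_mean k \<dots> = 0"
    by (rule gauss_mean_stein_rational) simp
  finally have G0: "(\<integral>x. G x \<partial>std_normal_distribution) = 0" .
  have K: "(\<integral>x. K x \<partial>std_normal_distribution) = risk_change (- m) k"
    by (simp add: K_def risk_change_def gauss_mean_def)
  have "integrable std_normal_distribution (\<lambda>x. (mse_limit s h (\<mu> + \<sigma> * x))\<^sup>2)"
    unfolding eq using intK intG std_normal_affine_square(1) by simp
  then show "integrable (normal_law \<mu> s) (\<lambda>x. (mse_limit s h x)\<^sup>2)"
    using s by (simp add: normal_law_eq_distr integrable_distr_eq \<sigma>_def)
  have "(\<integral>x. (mse_limit s h (\<mu> + \<sigma> * x))\<^sup>2 \<partial>std_normal_distribution)
      = \<mu>\<^sup>2 + \<sigma>\<^sup>2 + s * (risk_change (- m) k - 2 * 0)"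
    unfolding eq using intK intG std_normal_affine_square[of \<mu> \<sigma>] by (simp add: K G0)
  then show "(\<integral>x. (mse_limit s h x)\<^sup>2 \<partial>normal_law \<mu> s)
      = \<mu>\<^sup>2 + s + s * risk_change (- (\<mu> / sqrt s)) ((\<mu> - h) / sqrt s)"
    using s by (simp add: normal_law_eq_distr integral_distr \<sigma>_def m_def k_def)
qed

text \<open>For \<open>h = 0\<close> the limit map multiplies \<open>x\<close> by
  \<open>x\<^sup>2 / (x\<^sup>2 + s)\<close>, a factor in [0, 1). The squares are therefore strictly
  ordered away from 0, hence almost everywhere.\<close>

lemma mse_limit_0_second_moment_less:
  assumes s: "0 < s"
  shows "(\<integral>x. (mse_limit s 0 x)\<^sup>2 \<partial>normal_law \<mu> s) < (\<integral>x. x\<^sup>2 \<partial>normal_law \<mu> s)"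
proof -
  interpret prob_space "normal_law \<mu> s" using s by (rule prob_space_normal_law)
  show ?thesis
  proof (rule integral_less_AE_space)
    show "emeasure (normal_law \<mu> s) (space (normal_law \<mu> s)) \<noteq> 0"
      by (simp add: emeasure_space_1)
    have less: "(mse_limit s 0 x)\<^sup>2 < x\<^sup>2" if "x \<noteq> 0" for x
    proof -
      have pos: "0 < x\<^sup>2 + s" using s by (simp add: add_nonneg_pos)
      have "(mse_limit s 0 x)\<^sup>2 = x\<^sup>2 * (x\<^sup>2 / (x\<^sup>2 + s))\<^sup>2"
        unfolding power_mult_distrib[symmetric] using pos by (simp add: mse_limit_def field_simps)
      moreover have "0 \<le> x\<^sup>2 / (x\<^sup>2 + s)" "x\<^sup>2 / (x\<^sup>2 + s) < 1"
        using pos s by (simp_all add: divide_less_eq)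
      then have "(x\<^sup>2 / (x\<^sup>2 + s))\<^sup>2 < 1"
        unfolding abs_square_less_1 by (simp only: abs_of_nonneg)
      ultimately show ?thesis
        using that mult_strict_left_mono[of _ 1 "x\<^sup>2"] by simp
    qed
    have law: "normal_law \<mu> s = density lborel (\<lambda>x. ennreal (normal_density \<mu> (sqrt s) x))"
      using s by (simp add: normal_law_def)
    have "AE x in lborel. 0 < ennreal (normal_density \<mu> (sqrt s) x) \<longrightarrow> (mse_limit s 0 x)\<^sup>2 < x\<^sup>2"
      using AE_lborel_singleton[of 0] by eventually_elim (simp add: less)
    then show "AE x in normal_law \<mu> s. (mse_limit s 0 x)\<^sup>2 < x\<^sup>2"
      unfolding law by (subst AE_density) simp_all
  qed (use normal_law_second_moment mse_limit_second_moment s in auto)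
qed

theorem theorem3p2:
  fixes \<mu> \<rho> sC2 sE2 :: real and r :: "nat \<Rightarrow> real"
  assumes "sC2 > 0" and "sE2 \<ge> 0"
    and "filterlim r at_top sequentially"
    and "(\<lambda>n. r n / sqrt (real n)) \<longlonglongrightarrow> 0"
  shows
    "(\<forall>(b0::real) (bE::real) (D :: nat \<Rightarrow> 'w estimation).
        b0 \<noteq> bE \<and> asymptotic_setting \<mu> \<rho> sC2 sE2 r (\<lambda>_. b0) (\<lambda>_. bE) D \<longrightarrow>
        weak_conv_m (scaled_MSE_law r (\<lambda>_. b0) D) (normal_law \<mu> sC2))
     \<and>
     (\<forall>(b0 :: nat \<Rightarrow> real) (D :: nat \<Rightarrow> 'w estimation).
        asymptotic_setting \<mu> \<rho> sC2 sE2 r b0 b0 D \<longrightarrow>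
        (\<exists>(\<Omega> :: real measure) (U0 :: real \<Rightarrow> real).
           prob_space \<Omega> \<and> U0 \<in> borel_measurable \<Omega> \<and>
           weak_conv_m (scaled_MSE_law r b0 D) (distr \<Omega> borel U0) \<and>
           integrable \<Omega> (\<lambda>x. (U0 x)\<^sup>2) \<and>
           (\<integral>x. (U0 x)\<^sup>2 \<partial>\<Omega>) < (\<integral>x. x\<^sup>2 \<partial>normal_law \<mu> sC2)))
     \<and>
     (\<forall>(b0 :: nat \<Rightarrow> real) (D :: real \<Rightarrow> nat \<Rightarrow> 'w estimation).
        \<bar>\<mu> / sqrt sC2\<bar> \<le> 0.4 \<and>
        (\<forall>h. asymptotic_setting \<mu> \<rho> sC2 sE2 r b0 (\<lambda>n. b0 n + h / r n) (D h)) \<longrightarrow>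
        (\<exists>(\<Omega> :: real measure) (U :: real \<Rightarrow> real \<Rightarrow> real).
           prob_space \<Omega> \<and>
           (\<forall>h. U h \<in> borel_measurable \<Omega> \<and>
                weak_conv_m (scaled_MSE_law r b0 (D h)) (distr \<Omega> borel (U h)) \<and>
                integrable \<Omega> (\<lambda>x. (U h x)\<^sup>2)) \<and>
           (\<exists>h1 h2.
              is_arg_max (\<lambda>h. (\<integral>x. (U h x)\<^sup>2 \<partial>\<Omega>) - (\<mu>\<^sup>2 + sC2)) (\<lambda>_. True) h1 \<and>
              is_arg_max (\<lambda>h. \<mu>\<^sup>2 + sC2 - (\<integral>x. (U h x)\<^sup>2 \<partial>\<Omega>)) (\<lambda>_. True) h2 \<and>
              (\<integral>x. (U h1 x)\<^sup>2 \<partial>\<Omega>) - (\<mu>\<^sup>2 + sC2) < \<mu>\<^sup>2 + sC2 - (\<integral>x. (U h2 x)\<^sup>2 \<partial>\<Omega>))))"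
proof (intro conjI allI impI, goal_cases)
  case (1 b0 bE D)
  with assms show ?case
    by (intro scaled_MSE_weak_conv_fixed[of \<mu> \<rho> sC2 sE2 r b0 bE D]) auto
next
  case (2 b0 D)
  \<comment> \<open>Equal parameters are the local case \<open>h = 0\<close>.\<close>
  then have "asymptotic_setting \<mu> \<rho> sC2 sE2 r b0 (\<lambda>n. b0 n + 0 / r n) D" by simp
  from scaled_MSE_weak_conv_local[OF this assms(1,3,4)] assms(1) show ?case
    by (intro exI[of _ "normal_law \<mu> sC2"] exI[of _ "mse_limit sC2 0"] conjI prob_space_normal_law
        mse_limit_second_moment mse_limit_0_second_moment_less)
      (simp_all add: sets_normal_law cong: measurable_cong_sets)
next
  case (3 b0 D)
  define \<sigma> where "\<sigma> = sqrt sC2"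
  have \<sigma>: "0 < \<sigma>" using assms(1) by (simp add: \<sigma>_def)
  define M where "M = (\<lambda>h. \<integral>x. (mse_limit sC2 h x)\<^sup>2 \<partial>normal_law \<mu> sC2)"
  have M: "M h = \<mu>\<^sup>2 + sC2 + sC2 * risk_change (- (\<mu> / \<sigma>)) ((\<mu> - h) / \<sigma>)" for h
    using mse_limit_second_moment(2)[OF assms(1)] by (simp add: M_def \<sigma>_def)
  have "\<bar>- (\<mu> / \<sigma>)\<bar> \<le> 2/5" using 3 by (simp add: \<sigma>_def)
  from risk_change_max_less_min[OF this] obtain k1 k2 where
    k: "\<And>k. risk_change (- (\<mu> / \<sigma>)) k \<le> risk_change (- (\<mu> / \<sigma>)) k1"
      "\<And>k. risk_change (- (\<mu> / \<sigma>)) k2 \<le> risk_change (- (\<mu> / \<sigma>)) k"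
      "risk_change (- (\<mu> / \<sigma>)) k1 < - risk_change (- (\<mu> / \<sigma>)) k2"
    by blast
  \<comment> \<open>The centre \<open>(\<mu> - h) / \<sigma>\<close> runs through all reals as
    \<open>h\<close> does; solving for \<open>h\<close> turns extremal centres into extremal local
    parameters.\<close>
  define h1 where "h1 = \<mu> - \<sigma> * k1"
  define h2 where "h2 = \<mu> - \<sigma> * k2"
  have Mh: "M h1 = \<mu>\<^sup>2 + sC2 + sC2 * risk_change (- (\<mu> / \<sigma>)) k1"
    "M h2 = \<mu>\<^sup>2 + sC2 + sC2 * risk_change (- (\<mu> / \<sigma>)) k2"
    using \<sigma> by (simp_all add: M h1_def h2_def)
  have "M h \<le> M h1" "M h2 \<le> M h" for h
    unfolding Mh using k(1,2) assms(1) by (simp_all add: M)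
  then have args: "is_arg_max (\<lambda>h. M h - (\<mu>\<^sup>2 + sC2)) (\<lambda>_. True) h1"
    "is_arg_max (\<lambda>h. \<mu>\<^sup>2 + sC2 - M h) (\<lambda>_. True) h2"
    by (simp_all add: is_arg_max_linorder)
  have less: "M h1 - (\<mu>\<^sup>2 + sC2) < \<mu>\<^sup>2 + sC2 - M h2"
    unfolding Mh using mult_strict_left_mono[OF k(3) assms(1)] by simp
  have lim: "weak_conv_m (scaled_MSE_law r b0 (D h)) (distr (normal_law \<mu> sC2) borel (mse_limit sC2 h))" for h
    using 3 assms by (intro scaled_MSE_weak_conv_local) auto
  have "\<exists>h1 h2. is_arg_max (\<lambda>h. M h - (\<mu>\<^sup>2 + sC2)) (\<lambda>_. True) h1 \<and>
      is_arg_max (\<lambda>h. \<mu>\<^sup>2 + sC2 - M h) (\<lambda>_. True) h2 \<and>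
      M h1 - (\<mu>\<^sup>2 + sC2) < \<mu>\<^sup>2 + sC2 - M h2"
    using args less by blast
  moreover have "mse_limit sC2 h \<in> borel_measurable (normal_law \<mu> sC2)" for h
    using assms(1) by (simp add: sets_normal_law cong: measurable_cong_sets)
  ultimately show ?case
    unfolding M_def using lim assms(1) prob_space_normal_law mse_limit_second_moment(1)
    by (intro exI[of _ "normal_law \<mu> sC2"] exI[of _ "mse_limit sC2"]) blast
qed

end
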